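(* Let $\mathbb F$ be a finite field, let $H,F,G$ be finite-dimensional linear spaces over $\mathbb F$, and let $$\Gamma=\begin{pmatrix} 0 & 0 & B^* \\ 0 & 0 & C^* \\ B & C & A \end{pmatrix}:H\oplus F\oplus G\to H^*\oplus F^*\oplus G^*$$ be a symmetric linear operator with $A:G\to G^*$, $B:H\to G^*$ injective and $C:F\to G^*$. Then a graph code associated with $\Gamma$ is equivalent to stabilizer codes associated with the isotropic subspace $$S=\bigl\{(Ak+\hat t,k)\ \big|\ k\in\ker(B^* )\cap\ker(C^* ),\ \hat t\in\operatorname{ran}(C)\bigr\}\subset G^*\oplus G .$$
   Context: Fix a finite field $\mathbb F$; all linear spaces over $\mathbb F$ are finite-dimensional. $G^*$ is the dual space and $\langle\hat g,g\rangle\in\mathbb F$ the dual pairing. Fix a group isomorphism $\chi:\mathbb F\to\mathbb F^\wedge$ (additive group to its character group) with $\chi(a)(a')=\chi(a')(a)$; put $\varepsilon=\chi(1)$ and $\chi(\hat g|g):=\varepsilon(\langle\hat g,g\rangle)$. $L_2(G)$ is the space of all complex functions on $G$ with $\langle\psi,\psi'\rangle=\int dg\,\overline{\psi(g)}\psi'(g)$, where $\int dg$ is the normalized Haar measure (sum over $G$ divided by $|G|$). Weyl operators on $L_2(G)$: $(\mathbf w(\hat g,g)\psi)(g_1)=\chi(\hat g|g_1)\,\psi(g_1-g)$ for $(\hat g,g)\in G^*\oplus G$. A linear subspace $S\subset G^*\oplus G$ is isotropic if $\langle\hat g_0,g_1\rangle-\langle\hat g_1,g_0\rangle=0$ for all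 $(\hat g_0,g_0),(\hat g_1,g_1)\in S$. $\mathfrak A(G|S)$ is the complex algebra generated by the $\mathbf w(\hat g,g)$ with $(\hat g,g)\in S$; it is abelian for isotropic $S$. A character is a unital algebra homomorphism to $\mathbb C$. Stabilizer code associated with $(\zeta,S)$, for $S$ isotropic and $\zeta$ a character of $\mathfrak A(G|S)$: the isometric embedding $\mathbf v_{(\zeta,S)}$ of $\mathcal H(\zeta)=\{\psi\in L_2(G): a\psi=\zeta(a)\psi\ \forall a\in\mathfrak A(G|S)\}$ into $L_2(G)$. A stabilizer code associated with $S$ is any such $\mathbf v_{(\zeta,S)}$; for fixed $S$ these are all equivalent to each other in the sense below. Symmetric operator: a linear map $\Gamma:V\to V^*$ with $\Gamma^*=\Gamma$ (identifying $V^{**}=V$). For $\Gamma$ on $V=H\oplus F\oplus G$ of the displayed block form, put $S_\Gamma=\{(\Gamma v,v)\mid v\in V\}$, an isotropic subspace of $V^*\oplus V$. Given a character $\tilde\tau$ of $\mathfrak A(V|S_\Gamma)$, set $\tau(v)=\tilde\tau(\mathbf w(\Gamma v,v))$. The graph code associated with $(\tau,\Gamma)$ is the linear map $\mathbf v_{(\tau,\Gamma)}:L_2(H)\to L_2(G)$, $$(\mathbf v_{(\tau,\Gamma)}\psi)(g)=\sqrt{|H||F|}\int dh\,df\ \tau(h\oplus f\oplus g)\,\psi(h),$$ with normalized Haar measures. A graph code associated with $\Gamma$ is any $\mathbf v_{(\tau,\Gamma)}$ arising from such a $\tilde\tau$. The protected subspace of a code is its image in $L_2(G)$. Two codes with values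 in $L_2(G)$ are equivalent if some Weyl operator $\mathbf w(\hat g,g)$, $(\hat g,g)\in G^*\oplus G$, maps the protected subspace of one onto that of the other.
   Formalization: The formal claim covers every graph code that is not the zero map, and asserts that one exists: if C is not injective, some characters give the zero map, which is equivalent to no stabilizer code (e.g. H=G=0, F the field, C=0, τ a nontrivial character of F). *)

theory Defs
  imports Complex_Main "HOL-Library.Function_Algebras" "HOL-Library.Product_Plus"
begin

text \<open>
  A finite-dimensional linear space over the finite field \<open>'k\<close> is a type \<open>'g\<close> with a
  scalar multiplication \<open>s\<close>. Finiteness of \<open>'g\<close> is not assumed: it follows from
  finite-dimensionality, so all sums and cardinalities over \<open>UNIV\<close> below are genuine.
\<close>

definition fin_dim_space ::
    "('k::{field,finite} \<Rightarrow> 'g::ab_group_add \<Rightarrow> 'g) \<Rightarrow> bool" where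
  "fin_dim_space s \<longleftrightarrow> (\<exists>basis. finite_dimensional_vector_space s basis)"

definition prod_scale ::
    "('k \<Rightarrow> 'a \<Rightarrow> 'a) \<Rightarrow> ('k \<Rightarrow> 'b \<Rightarrow> 'b) \<Rightarrow> 'k \<Rightarrow> 'a \<times> 'b \<Rightarrow> 'a \<times> 'b" where
  "prod_scale s1 s2 c = (\<lambda>(x, y). (s1 c x, s2 c y))"

text \<open>
  The dual space consists of the linear functionals and carries the pointwise operations;
  the dual pairing is function application.
\<close>

definition dual_scale :: "'k::field \<Rightarrow> ('g \<Rightarrow> 'k) \<Rightarrow> 'g \<Rightarrow> 'k" where
  "dual_scale c \<phi> = (\<lambda>x. c * \<phi> x)"

definition dual :: "('k::field \<Rightarrow> 'g::ab_group_add \<Rightarrow> 'g) \<Rightarrow> ('g \<Rightarrow> 'k) set" where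
  "dual s = {\<phi>. Vector_Spaces.linear s (*) \<phi>}"

definition linear_to_dual ::
    "('k::field \<Rightarrow> 'v::ab_group_add \<Rightarrow> 'v) \<Rightarrow> ('k \<Rightarrow> 'w::ab_group_add \<Rightarrow> 'w)
      \<Rightarrow> ('v \<Rightarrow> ('w \<Rightarrow> 'k)) \<Rightarrow> bool" where
  "linear_to_dual s1 s2 T \<longleftrightarrow> Vector_Spaces.linear s1 dual_scale T \<and> range T \<subseteq> dual s2"

text \<open>The adjoint \<open>W \<rightarrow> V\<^sup>*\<close> of \<open>T : V \<rightarrow> W\<^sup>*\<close>, with \<open>W\<^sup>*\<^sup>*\<close> identified with \<open>W\<close>.\<close>

definition dual_adjoint :: "('v \<Rightarrow> ('w \<Rightarrow> 'k)) \<Rightarrow> ('w \<Rightarrow> ('v \<Rightarrow> 'k))" where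
  "dual_adjoint T = (\<lambda>y x. T x y)"

definition symmetric_operator ::
    "('k::field \<Rightarrow> 'v::ab_group_add \<Rightarrow> 'v) \<Rightarrow> ('v \<Rightarrow> ('v \<Rightarrow> 'k)) \<Rightarrow> bool" where
  "symmetric_operator s T \<longleftrightarrow> linear_to_dual s s T \<and> dual_adjoint T = T"

text \<open>\<open>H\<^sup>* \<oplus> F\<^sup>* \<oplus> G\<^sup>*\<close> as the dual of \<open>H \<oplus> F \<oplus> G\<close>.\<close>

definition dual_sum ::
    "('h \<Rightarrow> 'k::plus) \<Rightarrow> ('f \<Rightarrow> 'k) \<Rightarrow> ('g \<Rightarrow> 'k) \<Rightarrow> 'h \<times> 'f \<times> 'g \<Rightarrow> 'k" where
  "dual_sum \<phi> \<eta> \<theta> = (\<lambda>(h, f, g). \<phi> h + \<eta> f + \<theta> g)"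

definition block_operator ::
    "('g \<Rightarrow> ('g \<Rightarrow> 'k::plus)) \<Rightarrow> ('h \<Rightarrow> ('g \<Rightarrow> 'k)) \<Rightarrow> ('f \<Rightarrow> ('g \<Rightarrow> 'k))
      \<Rightarrow> 'h \<times> 'f \<times> 'g \<Rightarrow> ('h \<times> 'f \<times> 'g \<Rightarrow> 'k)" where
  "block_operator A B C =
     (\<lambda>(h, f, g). dual_sum (dual_adjoint B g) (dual_adjoint C g) (B h + C f + A g))"


definition characters :: "('a::ab_group_add \<Rightarrow> complex) set" where
  "characters = {\<gamma>. (\<forall>a. cmod (\<gamma> a) = 1) \<and> (\<forall>a b. \<gamma> (a + b) = \<gamma> a * \<gamma> b)}"

definition symmetric_character_iso :: "('k::ab_group_add \<Rightarrow> 'k \<Rightarrow> complex) \<Rightarrow> bool" where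
  "symmetric_character_iso \<chi> \<longleftrightarrow>
     bij_betw \<chi> UNIV characters \<and>
     (\<forall>a b. \<chi> (a + b) = (\<lambda>c. \<chi> a c * \<chi> b c)) \<and>
     (\<forall>a b. \<chi> a b = \<chi> b a)"

definition haar_integral :: "('a \<Rightarrow> complex) \<Rightarrow> complex" where
  "haar_integral u = (\<Sum>x\<in>UNIV. u x) / of_nat (card (UNIV :: 'a set))"


type_synonym 'g op = "('g \<Rightarrow> complex) \<Rightarrow> ('g \<Rightarrow> complex)"

definition weyl ::
    "('k::one \<Rightarrow> 'k \<Rightarrow> complex) \<Rightarrow> ('g::ab_group_add \<Rightarrow> 'k) \<Rightarrow> 'g \<Rightarrow> 'g op" where
  "weyl \<chi> \<phi> g \<psi> = (\<lambda>x. \<chi> 1 (\<phi> x) * \<psi> (x - g))"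

definition isotropic ::
    "('k::field \<Rightarrow> 'g::ab_group_add \<Rightarrow> 'g) \<Rightarrow> (('g \<Rightarrow> 'k) \<times> 'g) set \<Rightarrow> bool" where
  "isotropic s S \<longleftrightarrow>
     S \<subseteq> dual s \<times> UNIV \<and>
     module.subspace (prod_scale dual_scale s) S \<and>
     (\<forall>(\<phi>0, g0)\<in>S. \<forall>(\<phi>1, g1)\<in>S. \<phi>0 g1 - \<phi>1 g0 = 0)"

text \<open>
  The generated algebra contains the identity whenever \<open>S\<close> is a subspace, since
  \<open>weyl \<chi> 0 0 = id\<close> for \<open>\<chi> 1 \<in> characters\<close>.
\<close>

inductive_set weyl_algebra ::
    "('k::one \<Rightarrow> 'k \<Rightarrow> complex) \<Rightarrow> (('g::ab_group_add \<Rightarrow> 'k) \<times> 'g) set \<Rightarrow> 'g op set"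
  for \<chi> S where
  gen: "(\<phi>, g) \<in> S \<Longrightarrow> weyl \<chi> \<phi> g \<in> weyl_algebra \<chi> S"
| add: "a \<in> weyl_algebra \<chi> S \<Longrightarrow> b \<in> weyl_algebra \<chi> S \<Longrightarrow>
          (\<lambda>\<psi> x. a \<psi> x + b \<psi> x) \<in> weyl_algebra \<chi> S"
| scale: "a \<in> weyl_algebra \<chi> S \<Longrightarrow> (\<lambda>\<psi> x. c * a \<psi> x) \<in> weyl_algebra \<chi> S"
| mult: "a \<in> weyl_algebra \<chi> S \<Longrightarrow> b \<in> weyl_algebra \<chi> S \<Longrightarrow> a \<circ> b \<in> weyl_algebra \<chi> S"

definition algebra_character :: "'g op set \<Rightarrow> ('g op \<Rightarrow> complex) \<Rightarrow> bool" where
  "algebra_character \<AA> \<zeta> \<longleftrightarrow>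
     \<zeta> id = 1 \<and>
     (\<forall>a\<in>\<AA>. \<forall>b\<in>\<AA>. \<zeta> (\<lambda>\<psi> x. a \<psi> x + b \<psi> x) = \<zeta> a + \<zeta> b) \<and>
     (\<forall>a\<in>\<AA>. \<forall>c. \<zeta> (\<lambda>\<psi> x. c * a \<psi> x) = c * \<zeta> a) \<and>
     (\<forall>a\<in>\<AA>. \<forall>b\<in>\<AA>. \<zeta> (a \<circ> b) = \<zeta> a * \<zeta> b)"


text \<open>A code is a map into \<open>L\<^sub>2(G)\<close> together with its domain.\<close>

type_synonym ('a, 'g) code = "'a set \<times> ('a \<Rightarrow> ('g \<Rightarrow> complex))"

definition protected_subspace :: "('a, 'g) code \<Rightarrow> ('g \<Rightarrow> complex) set" where
  "protected_subspace = (\<lambda>(K, v). v ` K)"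

definition equivalent_codes ::
    "('k::field \<Rightarrow> 'k \<Rightarrow> complex) \<Rightarrow> ('k \<Rightarrow> 'g::ab_group_add \<Rightarrow> 'g)
      \<Rightarrow> ('a, 'g) code \<Rightarrow> ('b, 'g) code \<Rightarrow> bool" where
  "equivalent_codes \<chi> s c c' \<longleftrightarrow>
     (\<exists>\<phi>\<in>dual s. \<exists>g. weyl \<chi> \<phi> g ` protected_subspace c = protected_subspace c')"

definition eigenspace ::
    "('k::one \<Rightarrow> 'k \<Rightarrow> complex) \<Rightarrow> (('g::ab_group_add \<Rightarrow> 'k) \<times> 'g) set
      \<Rightarrow> ('g op \<Rightarrow> complex) \<Rightarrow> ('g \<Rightarrow> complex) set" where
  "eigenspace \<chi> S \<zeta> = {\<psi>. \<forall>a\<in>weyl_algebra \<chi> S. a \<psi> = (\<lambda>x. \<zeta> a * \<psi> x)}"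

definition stabilizer_code ::
    "('k::one \<Rightarrow> 'k \<Rightarrow> complex) \<Rightarrow> (('g::ab_group_add \<Rightarrow> 'k) \<times> 'g) set
      \<Rightarrow> ('g op \<Rightarrow> complex) \<Rightarrow> ('g \<Rightarrow> complex, 'g) code" where
  "stabilizer_code \<chi> S \<zeta> = (eigenspace \<chi> S \<zeta>, \<lambda>\<psi>. \<psi>)"

definition is_stabilizer_code ::
    "('k::one \<Rightarrow> 'k \<Rightarrow> complex) \<Rightarrow> (('g::ab_group_add \<Rightarrow> 'k) \<times> 'g) set
      \<Rightarrow> ('g \<Rightarrow> complex, 'g) code \<Rightarrow> bool" where
  "is_stabilizer_code \<chi> S c \<longleftrightarrow>
     (\<exists>\<zeta>. algebra_character (weyl_algebra \<chi> S) \<zeta> \<and> c = stabilizer_code \<chi> S \<zeta>)"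

definition graph_subspace :: "('v \<Rightarrow> ('v \<Rightarrow> 'k)) \<Rightarrow> (('v \<Rightarrow> 'k) \<times> 'v) set" where
  "graph_subspace T = {(T v, v) | v. True}"

definition graph_code ::
    "('h \<times> 'f \<times> 'g \<Rightarrow> complex) \<Rightarrow> ('h \<Rightarrow> complex, 'g) code" where
  "graph_code \<tau> =
     (UNIV, \<lambda>\<psi> g.
        complex_of_real (sqrt (real (card (UNIV :: 'h set)) * real (card (UNIV :: 'f set)))) *
        haar_integral (\<lambda>h. haar_integral (\<lambda>f. \<tau> (h, f, g) * \<psi> h)))"

text \<open>
  If the lower middle block \<open>C\<close> of \<open>T\<close> is not injective, some characters yield the zero
  map: restricted to \<open>F\<close>, \<open>\<tau>\<close> is an additive character, which can be nontrivial on
  \<open>ker C\<close>, and then the integral over \<open>f\<close> vanishes. The zero map is not excluded here;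
  statements about equivalence of codes must exclude it explicitly.
\<close>

definition is_graph_code ::
    "('k::one \<Rightarrow> 'k \<Rightarrow> complex)
      \<Rightarrow> ('h::ab_group_add \<times> 'f::ab_group_add \<times> 'g::ab_group_add \<Rightarrow> ('h \<times> 'f \<times> 'g \<Rightarrow> 'k))
      \<Rightarrow> ('h \<Rightarrow> complex, 'g) code \<Rightarrow> bool" where
  "is_graph_code \<chi> T c \<longleftrightarrow>
     (\<exists>\<zeta>. algebra_character (weyl_algebra \<chi> (graph_subspace T)) \<zeta> \<and>
          c = graph_code (\<lambda>v. \<zeta> (weyl \<chi> (T v) v)))"

end

theory Submission
  imports Defs "HOL-Library.Cardinality"
begin

text \<open>
  Both protected subspaces are joint eigenspaces of the commuting Weyl operators
  \<open>w(C f, 0)\<close> and \<open>w(A k, k)\<close> with \<open>k \<in> ker B\<^sup>* \<inter> ker C\<^sup>*\<close>. For the stabilizer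
  code this is immediate. For the graph code, \<open>\<tau>\<close> factors as
  \<open>\<tau>\<^sub>H(h) \<tau>\<^sub>F(f) \<tau>\<^sub>G(g) \<epsilon>(\<langle>B h, g\<rangle> + \<langle>C f, g\<rangle>)\<close>: the integral over \<open>f\<close> restricts the support
  to a coset of \<open>ker C\<^sup>*\<close> (or to nothing, when the code is zero), and by Fourier inversion
  the integral over \<open>h\<close> produces every function invariant under \<open>ker B\<^sup>*\<close>, multiplied by
  \<open>\<tau>\<^sub>G\<close>. Conjugation by \<open>w(\<phi>, d)\<close> multiplies the eigenvalues by
  \<open>\<epsilon>(\<langle>C f, d\<rangle>)\<close> and \<open>\<epsilon>(\<langle>A k, d\<rangle> - \<langle>\<phi>, k\<rangle>)\<close>, and the eigenvalue systems of two nonzero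
  joint eigenspaces always differ by such factors. A nonzero graph code exists because \<open>A\<close> has a quadratic
  phase \<open>q(x + y) = \<epsilon>(\<langle>A y, x\<rangle>) q(x) q(y)\<close>, read off a common eigenvector of the
  operators \<open>w(A x, x)\<close>; this covers characteristic 2, where \<open>\<epsilon>(\<langle>A x, x\<rangle> / 2)\<close> is
  unavailable.
\<close>

section \<open>Finite-dimensional spaces and their duals\<close>

text \<open>Adjoining a vector \<open>a\<close> to a finite set replaces its span by the union of
  the translates by multiples of \<open>a\<close>, and there are only finitely many scalars.
  Induction then reaches the span of a basis.\<close>

lemma fin_dim_space_finite:
  fixes s :: "'k::{field,finite} \<Rightarrow> 'g::ab_group_add \<Rightarrow> 'g"
  assumes "fin_dim_space s"
  shows "finite (UNIV :: 'g set)"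
proof -
  obtain b where "finite_dimensional_vector_space s b"
    using assms by (auto simp: fin_dim_space_def)
  then interpret finite_dimensional_vector_space s b .
  have "finite (span X)" if "finite X" for X
    using that
  proof induction
    case (insert a X)
    have "span (insert a X) \<subseteq> (\<Union>c\<in>UNIV. (\<lambda>y. s c a + y) ` span X)"
    proof
      fix x assume "x \<in> span (insert a X)"
      then obtain c where "x - s c a \<in> span X"
        by (auto simp: span_insert)
      then have "x \<in> (\<lambda>y. s c a + y) ` span X"
        by (intro image_eqI[of _ _ "x - s c a"]) auto
      then show "x \<in> (\<Union>c\<in>UNIV. (\<lambda>y. s c a + y) ` span X)" by blast
    qed
    then show ?case
      by (rule finite_subset) (use insert.IH in auto)
  qed simp
  from this[OF finite_Basis] show ?thesis
    by (simp add: span_Basis)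
qed

text \<open>A nonzero vector forms an independent set, so the value 1 at \<open>x\<close> extends to
  a linear functional.\<close>

lemma dual_separates:
  fixes s :: "'k::{field,finite} \<Rightarrow> 'g::ab_group_add \<Rightarrow> 'g"
  assumes "fin_dim_space s" and "x \<noteq> 0"
  shows "\<exists>\<phi>\<in>dual s. \<phi> x \<noteq> 0"
proof -
  obtain b where "finite_dimensional_vector_space s b"
    using assms by (auto simp: fin_dim_space_def)
  then interpret finite_dimensional_vector_space s b .
  interpret vector_space_pair s "(*) :: 'k \<Rightarrow> 'k \<Rightarrow> 'k"
    by unfold_locales (auto simp: algebra_simps)
  have "independent {x}" using assms(2) by simp
  from linear_independent_extend[OF this, of "\<lambda>_. 1"] show ?thesis
    by (auto simp: dual_def)
qed

lemma fin_dim_space_vector_space: "fin_dim_space s \<Longrightarrow> vector_space s"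
  by (auto simp: fin_dim_space_def finite_dimensional_vector_space_def)

lemma mem_dual_iff:
  fixes s :: "'k::field \<Rightarrow> 'g::ab_group_add \<Rightarrow> 'g"
  assumes "vector_space s"
  shows "\<phi> \<in> dual s \<longleftrightarrow> (\<forall>x y. \<phi> (x + y) = \<phi> x + \<phi> y) \<and> (\<forall>c x. \<phi> (s c x) = c * \<phi> x)"
proof -
  have "vector_space ((*) :: 'k \<Rightarrow> 'k \<Rightarrow> 'k)"
    by unfold_locales (auto simp: algebra_simps)
  then show ?thesis
    using assms
    by (auto simp: dual_def Vector_Spaces.linear_iff)
qed

lemma dual_add: "\<phi> \<in> dual s \<Longrightarrow> \<phi> (x + y) = \<phi> x + \<phi> y"
  by (simp add: dual_def Vector_Spaces.linear_iff)

lemma dual_smult: "\<phi> \<in> dual s \<Longrightarrow> \<phi> (s c x) = c * \<phi> x"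
  by (simp add: dual_def Vector_Spaces.linear_iff)

lemma dual_zero: "\<phi> \<in> dual s \<Longrightarrow> \<phi> 0 = 0"
  using dual_add[of \<phi> s 0 0] by (simp only: add_0_left add_cancel_right_right)

lemma dual_uminus: "\<phi> \<in> dual s \<Longrightarrow> \<phi> (- x) = - \<phi> x"
  using dual_add[of \<phi> s x "- x"] by (simp add: dual_zero eq_neg_iff_add_eq_0 add.commute)

lemma dual_diff: "\<phi> \<in> dual s \<Longrightarrow> \<phi> (x - y) = \<phi> x - \<phi> y"
  using dual_add[of \<phi> s x "- y"] by (simp add: dual_uminus)

section \<open>Character sums and duality of finite groups\<close>

text \<open>Translation by \<open>q\<close> permutes \<open>Q\<close> and multiplies the sum by
  \<open>\<gamma> q\<close>, which differs from 1. This orthogonality relation evaluates all Fourier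
  sums below.\<close>

lemma sum_nontrivial_character:
  fixes \<gamma> :: "'a::ab_group_add \<Rightarrow> complex"
  assumes Q: "\<And>x y. x \<in> Q \<Longrightarrow> y \<in> Q \<Longrightarrow> x - y \<in> Q" "\<And>x y. x \<in> Q \<Longrightarrow> y \<in> Q \<Longrightarrow> x + y \<in> Q"
    and q: "q \<in> Q" "\<gamma> q \<noteq> 1"
    and \<gamma>: "\<And>x. x \<in> Q \<Longrightarrow> \<gamma> (q + x) = \<gamma> q * \<gamma> x"
  shows "sum \<gamma> Q = 0"
proof -
  have "sum \<gamma> Q = (\<Sum>x\<in>Q. \<gamma> (q + x))"
    by (rule sum.reindex_bij_witness[of _ "\<lambda>x. q + x" "\<lambda>x. x - q"]) (use Q q in auto)
  also have "\<dots> = \<gamma> q * sum \<gamma> Q"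
    by (simp add: \<gamma> sum_distrib_left)
  finally show ?thesis using q(2) by simp
qed

text \<open>
  Averaging \<open>\<Sum>p. \<sigma> (- p) * \<beta> p q\<close> over all \<open>q\<close> leaves only the term \<open>p = 0\<close>, so for some \<open>q\<close>
  the sum is nonzero; then the character \<open>\<lambda>p. \<sigma> (- p) * \<beta> p q\<close> is trivial.
\<close>
lemma character_eq_pairing:
  fixes \<sigma> :: "'a::ab_group_add \<Rightarrow> complex" and \<beta> :: "'a \<Rightarrow> 'b::ab_group_add \<Rightarrow> complex"
  assumes P: "finite P" "0 \<in> P" "\<And>x y. x \<in> P \<Longrightarrow> y \<in> P \<Longrightarrow> x - y \<in> P"
    and Q: "finite Q" "0 \<in> Q" "\<And>x y. x \<in> Q \<Longrightarrow> y \<in> Q \<Longrightarrow> x - y \<in> Q"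
    and \<beta>_left: "\<And>p p' q. p \<in> P \<Longrightarrow> p' \<in> P \<Longrightarrow> q \<in> Q \<Longrightarrow> \<beta> (p + p') q = \<beta> p q * \<beta> p' q"
    and \<beta>_right: "\<And>p q q'. p \<in> P \<Longrightarrow> q \<in> Q \<Longrightarrow> q' \<in> Q \<Longrightarrow> \<beta> p (q + q') = \<beta> p q * \<beta> p q'"
    and \<beta>_zero: "\<And>q. q \<in> Q \<Longrightarrow> \<beta> 0 q = 1"
    and nondegenerate: "\<And>p. p \<in> P \<Longrightarrow> p \<noteq> 0 \<Longrightarrow> \<exists>q\<in>Q. \<beta> p q \<noteq> 1"
    and \<sigma>: "\<And>p p'. p \<in> P \<Longrightarrow> p' \<in> P \<Longrightarrow> \<sigma> (p + p') = \<sigma> p * \<sigma> p'" "\<sigma> 0 = 1"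
  shows "\<exists>q\<in>Q. \<forall>p\<in>P. \<sigma> p = \<beta> p q"
proof -
  have P_uminus: "- x \<in> P" if "x \<in> P" for x
    using P(3)[OF P(2) that] by simp
  have P_add: "x + y \<in> P" if "x \<in> P" "y \<in> P" for x y
    using P(3)[OF that(1) P_uminus[OF that(2)]] by simp
  have Q_add: "x + y \<in> Q" if "x \<in> Q" "y \<in> Q" for x y
    using Q(3)[OF that(1) Q(3)[OF Q(2) that(2)]] by simp
  have inner: "(\<Sum>q\<in>Q. \<beta> p q) = (if p = 0 then of_nat (card Q) else 0)" if p: "p \<in> P" for p
  proof (cases "p = 0")
    case False
    then obtain q where q: "q \<in> Q" "\<beta> p q \<noteq> 1" using nondegenerate p by blast
    show ?thesis
      using sum_nontrivial_character[of Q q "\<beta> p"] Q(3) Q_add q \<beta>_right p False by auto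
  qed (simp add: \<beta>_zero)
  have "(\<Sum>q\<in>Q. \<Sum>p\<in>P. \<sigma> (- p) * \<beta> p q) = (\<Sum>p\<in>P. \<sigma> (- p) * (\<Sum>q\<in>Q. \<beta> p q))"
    by (subst sum.swap) (simp add: sum_distrib_left)
  also have "\<dots> = (\<Sum>p\<in>P. if p = 0 then of_nat (card Q) else 0)"
    by (intro sum.cong) (auto simp: inner \<sigma>(2))
  also have "\<dots> = of_nat (card Q)"
    using P by simp
  also have "\<dots> \<noteq> 0"
    using Q by auto
  finally have "\<exists>q\<in>Q. (\<Sum>p\<in>P. \<sigma> (- p) * \<beta> p q) \<noteq> 0"
    by (meson sum.neutral)
  then obtain q where q: "q \<in> Q" "(\<Sum>p\<in>P. \<sigma> (- p) * \<beta> p q) \<noteq> 0" by blast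
  have "\<sigma> p = \<beta> p q" if p: "p \<in> P" for p
  proof -
    have "\<sigma> (- p) * \<beta> p q = 1"
    proof (rule ccontr)
      assume neq: "\<sigma> (- p) * \<beta> p q \<noteq> 1"
      have "\<sigma> (- (p + x)) * \<beta> (p + x) q = \<sigma> (- p) * \<beta> p q * (\<sigma> (- x) * \<beta> x q)" if "x \<in> P" for x
        using \<sigma>(1)[OF P_uminus[OF p] P_uminus[OF that]] \<beta>_left[OF p that q(1)]
        by (simp add: algebra_simps)
      then have "(\<Sum>p\<in>P. \<sigma> (- p) * \<beta> p q) = 0"
        using sum_nontrivial_character[of P p "\<lambda>p. \<sigma> (- p) * \<beta> p q"] P(3) P_add p neq
        by blast
      with q(2) show False by simp
    qed
    moreover have "\<sigma> p * \<sigma> (- p) = 1"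
      using \<sigma>(1)[OF p P_uminus[OF p]] \<sigma>(2) by simp
    ultimately show ?thesis
      by (metis mult.assoc mult.left_neutral mult.right_neutral)
  qed
  with q(1) show ?thesis by blast
qed

section \<open>Phases and Weyl operators\<close>

locale character_iso =
  fixes \<chi> :: "'k::{field,finite} \<Rightarrow> 'k \<Rightarrow> complex"
  assumes \<chi>: "symmetric_character_iso \<chi>"
begin

abbreviation \<epsilon> :: "'k \<Rightarrow> complex" where "\<epsilon> \<equiv> \<chi> 1"

lemma \<epsilon>_char: "\<epsilon> \<in> characters"
  using \<chi> by (auto simp: symmetric_character_iso_def bij_betw_def)

lemma \<epsilon>_add: "\<epsilon> (a + b) = \<epsilon> a * \<epsilon> b"
  using \<epsilon>_char by (auto simp: characters_def)

lemma \<epsilon>_nonzero [simp]: "\<epsilon> a \<noteq> 0"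
proof -
  have "cmod (\<epsilon> a) = 1"
    using \<epsilon>_char by (auto simp: characters_def)
  then show ?thesis by auto
qed

lemma \<epsilon>_0 [simp]: "\<epsilon> 0 = 1"
  using \<epsilon>_add[of 0 0] \<epsilon>_nonzero[of 0] by simp

lemma \<epsilon>_uminus: "\<epsilon> (- a) = inverse (\<epsilon> a)"
  using \<epsilon>_add[of a "- a"] by (simp add: inverse_unique)

lemma \<epsilon>_diff: "\<epsilon> (a - b) = \<epsilon> a / \<epsilon> b"
  using \<epsilon>_add[of a "- b"] by (simp add: \<epsilon>_uminus divide_inverse)

text \<open>If \<open>\<epsilon>\<close> were trivial, it would coincide with
  \<open>\<chi> 0\<close>, and injectivity of \<open>\<chi>\<close> would identify 1 with 0.\<close>

lemma \<epsilon>_nontrivial: "\<exists>a. \<epsilon> a \<noteq> 1"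
proof (rule ccontr)
  assume "\<not> (\<exists>a. \<epsilon> a \<noteq> 1)"
  then have 1: "\<epsilon> a = 1" for a by blast
  have "\<chi> (1 + 0) = (\<lambda>c. \<epsilon> c * \<chi> 0 c)"
    using \<chi> unfolding symmetric_character_iso_def by blast
  then have "\<epsilon> = \<chi> 0" by (auto simp: 1)
  moreover have "inj \<chi>"
    using \<chi> by (simp add: symmetric_character_iso_def bij_betw_def)
  ultimately have "(1::'k) = 0" by (rule injD[rotated])
  then show False by simp
qed

text \<open>Multiples of \<open>a\<close> exhaust the field. By rescaling a vector, any nonzero
  value of a functional can thus be turned into a nontrivial phase.\<close>

lemma \<epsilon>_mult_nontrivial: "a \<noteq> 0 \<Longrightarrow> \<exists>c. \<epsilon> (c * a) \<noteq> 1"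
  using \<epsilon>_nontrivial by (metis nonzero_divide_eq_eq)

text \<open>The phase arises because \<open>\<phi>'\<close> is evaluated at the shifted point
  \<open>x - g\<close>. Consequently two Weyl operators commute as soon as
  \<open>\<phi> g' = \<phi>' g\<close>.\<close>

lemma weyl_comp:
  assumes "\<phi>' \<in> dual s"
  shows "weyl \<chi> \<phi> g (weyl \<chi> \<phi>' g' \<psi>) = (\<lambda>x. \<epsilon> (- \<phi>' g) * weyl \<chi> (\<phi> + \<phi>') (g + g') \<psi> x)"
  using assms by (auto simp: weyl_def dual_diff \<epsilon>_add \<epsilon>_diff \<epsilon>_uminus divide_simps diff_diff_add fun_eq_iff)

lemma weyl_zero: "weyl \<chi> 0 0 = id"
  by (auto simp: weyl_def fun_eq_iff)

lemma weyl_scale: "weyl \<chi> \<phi> g (\<lambda>x. c * \<psi> x) = (\<lambda>x. c * weyl \<chi> \<phi> g \<psi> x)"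
  by (auto simp: weyl_def fun_eq_iff)

lemma weyl_sum:
  "weyl \<chi> \<phi> g (\<lambda>x. \<Sum>i\<in>I. c i * f i x) = (\<lambda>x. \<Sum>i\<in>I. c i * weyl \<chi> \<phi> g (f i) x)"
  by (auto simp: weyl_def fun_eq_iff sum_distrib_left intro!: sum.cong)

section \<open>Algebras generated by Weyl operators and their characters\<close>

text \<open>The type of operators does not enforce linearity; homogeneity is recovered by induction
  so that eigenvalues can be pulled through compositions.\<close>

lemma weyl_algebra_scale:
  assumes "a \<in> weyl_algebra \<chi> S"
  shows "a (\<lambda>x. c * \<psi> x) = (\<lambda>x. c * a \<psi> x)"
  using assms
  by (induction arbitrary: \<psi>) (auto simp: weyl_scale algebra_simps)

lemma eigenspace_eq_generators:
  assumes "algebra_character (weyl_algebra \<chi> S) \<zeta>"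
  shows "eigenspace \<chi> S \<zeta> =
    {\<psi>. \<forall>(\<phi>, g)\<in>S. weyl \<chi> \<phi> g \<psi> = (\<lambda>x. \<zeta> (weyl \<chi> \<phi> g) * \<psi> x)}"
proof -
  have "a \<psi> = (\<lambda>x. \<zeta> a * \<psi> x)"
    if "a \<in> weyl_algebra \<chi> S" and "\<forall>(\<phi>, g)\<in>S. weyl \<chi> \<phi> g \<psi> = (\<lambda>x. \<zeta> (weyl \<chi> \<phi> g) * \<psi> x)" for a \<psi>
    using that(1)
  proof induction
    case (gen \<phi> g)
    then show ?case using that(2) by blast
  next
    case (add a b)
    then show ?case using assms by (auto simp: algebra_character_def algebra_simps)
  next
    case (scale a c)
    then show ?case using assms by (auto simp: algebra_character_def algebra_simps)
  next
    case (mult a b)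
    have "\<zeta> (a \<circ> b) = \<zeta> a * \<zeta> b"
      using assms mult.hyps by (simp add: algebra_character_def)
    moreover have "a (\<lambda>x. \<zeta> b * \<psi> x) = (\<lambda>x. \<zeta> b * (\<zeta> a * \<psi> x))"
      by (simp only: weyl_algebra_scale[OF mult.hyps(1)] mult.IH)
    ultimately show ?case
      by (simp only: comp_apply[of a b \<psi>] mult.IH mult.assoc mult.left_commute)
  qed
  then show ?thesis
    by (auto simp: eigenspace_def intro: weyl_algebra.gen)
qed

text \<open>This is \<open>\<zeta>\<close> applied to the operator identity
  \<open>weyl_comp\<close>. All three pairs must lie in \<open>S\<close>, since
  \<open>\<zeta>\<close> is constrained only on the algebra.\<close>

lemma algebra_character_weyl_comp:
  assumes \<zeta>: "algebra_character (weyl_algebra \<chi> S) \<zeta>"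
    and S: "(\<phi>, g) \<in> S" "(\<phi>', g') \<in> S" "(\<phi> + \<phi>', g + g') \<in> S" and "\<phi>' \<in> dual s"
  shows "\<zeta> (weyl \<chi> \<phi> g) * \<zeta> (weyl \<chi> \<phi>' g') = \<epsilon> (- \<phi>' g) * \<zeta> (weyl \<chi> (\<phi> + \<phi>') (g + g'))"
proof -
  have "weyl \<chi> \<phi> g \<circ> weyl \<chi> \<phi>' g' = (\<lambda>\<psi> x. \<epsilon> (- \<phi>' g) * weyl \<chi> (\<phi> + \<phi>') (g + g') \<psi> x)"
    using assms by (auto simp: weyl_comp fun_eq_iff)
  then show ?thesis
    using \<zeta> S[THEN weyl_algebra.gen[where \<chi> = \<chi>]] unfolding algebra_character_def by metis
qed

text \<open>The quotient is the eigenvalue of \<open>a\<close> on \<open>\<psi>\<close>, read off at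
  the point \<open>z\<close>. A common eigenvector of the generators is one for the whole algebra,
  which makes its eigenvalues multiplicative.\<close>

lemma algebra_character_of_eigenvector:
  assumes eig: "\<And>\<phi> g. (\<phi>, g) \<in> S \<Longrightarrow> weyl \<chi> \<phi> g \<psi> = (\<lambda>x. \<kappa> \<phi> g * \<psi> x)" and nz: "\<psi> z \<noteq> 0"
  shows "algebra_character (weyl_algebra \<chi> S) (\<lambda>a. a \<psi> z / \<psi> z)"
proof -
  have eigenvector: "\<exists>c. a \<psi> = (\<lambda>x. c * \<psi> x)" if "a \<in> weyl_algebra \<chi> S" for a
    using that
  proof induction
    case (gen \<phi> g)
    then show ?case using eig by blast
  next
    case (add a b)
    then obtain c d where "a \<psi> = (\<lambda>x. c * \<psi> x)" "b \<psi> = (\<lambda>x. d * \<psi> x)" by blast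
    then show ?case by (intro exI[of _ "c + d"]) (auto simp: algebra_simps)
  next
    case (scale a c)
    then obtain d where "a \<psi> = (\<lambda>x. d * \<psi> x)" by blast
    then show ?case by (intro exI[of _ "c * d"]) (simp add: mult.assoc)
  next
    case (mult a b)
    then obtain c d where "a \<psi> = (\<lambda>x. c * \<psi> x)" "b \<psi> = (\<lambda>x. d * \<psi> x)" by blast
    then show ?case
      using weyl_algebra_scale[OF mult.hyps(1)] by (intro exI[of _ "c * d"]) (auto simp: algebra_simps)
  qed
  have "(a \<circ> b) \<psi> z / \<psi> z = a \<psi> z / \<psi> z * (b \<psi> z / \<psi> z)"
    if a: "a \<in> weyl_algebra \<chi> S" and b: "b \<in> weyl_algebra \<chi> S" for a b
  proof -
    obtain d where "b \<psi> = (\<lambda>x. d * \<psi> x)" using eigenvector[OF b] by blast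
    then show ?thesis using nz by (simp add: weyl_algebra_scale[OF a])
  qed
  then show ?thesis
    using nz by (auto simp: algebra_character_def add_divide_distrib)
qed

section \<open>Common eigenvectors of commuting Weyl operators\<close>

text \<open>Both \<open>of_nat i\<close> are scalars of the field, so the functional and the shift
  disappear when \<open>i\<close> is the characteristic. Only the nonvanishing of the accumulated
  phase matters, hence the existential \<open>c\<close>.\<close>

lemma weyl_funpow:
  assumes s: "vector_space s" and \<phi>: "\<phi> \<in> dual s"
  shows "\<exists>c. c \<noteq> 0 \<and> (\<forall>\<psi>. (weyl \<chi> \<phi> g ^^ i) \<psi>
    = (\<lambda>x. c * \<epsilon> (of_nat i * \<phi> x) * \<psi> (x - s (of_nat i) g)))"
proof (induction i)
  case 0
  interpret vector_space s by fact
  show ?case by (intro exI[of _ 1]) auto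
next
  case (Suc i)
  interpret vector_space s by fact
  from Suc obtain c where c: "c \<noteq> 0"
    "(weyl \<chi> \<phi> g ^^ i) \<psi> = (\<lambda>x. c * \<epsilon> (of_nat i * \<phi> x) * \<psi> (x - s (of_nat i) g))" for \<psi> by blast
  have "(weyl \<chi> \<phi> g ^^ Suc i) \<psi> = (\<lambda>x. (c * \<epsilon> (- (of_nat i * \<phi> g))) *
      \<epsilon> (of_nat (Suc i) * \<phi> x) * \<psi> (x - s (of_nat (Suc i)) g))" for \<psi>
  proof
    fix x
    have "x - g - s (of_nat i) g = x - s (of_nat (Suc i)) g"
      by (simp add: scale_left_distrib diff_diff_add)
    moreover have "\<epsilon> (\<phi> x) * \<epsilon> (of_nat i * \<phi> (x - g)) =
        \<epsilon> (- (of_nat i * \<phi> g)) * \<epsilon> (of_nat (Suc i) * \<phi> x)"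
      by (simp add: dual_diff[OF \<phi>] algebra_simps flip: \<epsilon>_add)
    moreover have "(weyl \<chi> \<phi> g ^^ Suc i) \<psi> x =
        c * (\<epsilon> (\<phi> x) * \<epsilon> (of_nat i * \<phi> (x - g))) * \<psi> (x - g - s (of_nat i) g)"
      by (simp add: c(2) weyl_def[of \<chi> \<phi> g])
    ultimately show "(weyl \<chi> \<phi> g ^^ Suc i) \<psi> x = (c * \<epsilon> (- (of_nat i * \<phi> g))) *
        \<epsilon> (of_nat (Suc i) * \<phi> x) * \<psi> (x - s (of_nat (Suc i)) g)"
      by (simp only: mult.assoc)
  qed
  with c(1) show ?case
    by (intro exI[of _ "c * \<epsilon> (- (of_nat i * \<phi> g))"]) simp
qed

text \<open>
  Some power of a Weyl operator \<open>W\<close> is a nonzero scalar \<open>\<mu>\<close>. The vectors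
  \<open>\<Sum>i<n. z ^ i * W ^ i \<psi>\<close> with \<open>\<mu> * z ^ n = 1\<close> are eigenvectors of \<open>W\<close>, and they cannot
  vanish for all \<open>n\<close> values of \<open>z\<close>, being polynomials in \<open>z\<close> of degree less than \<open>n\<close>.
\<close>
lemma weyl_eigenvector:
  assumes s: "vector_space s" and \<phi>: "\<phi> \<in> dual s" and nz: "\<psi> y \<noteq> 0"
  shows "\<exists>c (n::nat) \<kappa> z. (\<Sum>i<n. c i * (weyl \<chi> \<phi> g ^^ i) \<psi> z) \<noteq> 0 \<and>
    weyl \<chi> \<phi> g (\<lambda>x. \<Sum>i<n. c i * (weyl \<chi> \<phi> g ^^ i) \<psi> x) =
      (\<lambda>x. \<kappa> * (\<Sum>i<n. c i * (weyl \<chi> \<phi> g ^^ i) \<psi> x))"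
proof -
  interpret vector_space s by fact
  \<comment> \<open>By \<open>weyl_funpow\<close>, the power with this exponent is a scalar.\<close>
  define n where "n = CHAR('k)"
  have n: "n > 0" "of_nat n = (0::'k)"
    by (simp_all add: n_def finite_imp_CHAR_pos)
  define W where "W = weyl \<chi> \<phi> g"
  obtain \<mu> where \<mu>: "\<mu> \<noteq> 0" "(W ^^ n) \<psi> = (\<lambda>x. \<mu> * \<psi> x)"
    using weyl_funpow[OF s \<phi>, where g = g and i = n] n by (auto simp: W_def)
  have "\<not> {z. z ^ n = 1 / \<mu>} \<subseteq> {z. (\<Sum>i\<le>n - 1. (W ^^ i) \<psi> y * z ^ i) = 0}"
  proof
    let ?R = "{z. (\<Sum>i\<le>n - 1. (W ^^ i) \<psi> y * z ^ i) = 0}"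
    assume sub: "{z. z ^ n = 1 / \<mu>} \<subseteq> ?R"
    \<comment> \<open>The polynomial is not zero: its constant coefficient is
      \<open>\<psi> y\<close>.\<close>
    have R: "finite ?R \<and> card ?R \<le> n - 1"
      by (rule polyfun_rootbound[of _ 0]) (use nz in auto)
    have "n \<le> card ?R"
      using card_mono[OF _ sub] R card_nth_roots[of "1 / \<mu>" n] \<mu>(1) n(1) by simp
    with R n(1) show False by linarith
  qed
  then obtain z where z: "z ^ n = 1 / \<mu>" "(\<Sum>i\<le>n - 1. (W ^^ i) \<psi> y * z ^ i) \<noteq> 0" by blast
  have z0: "z \<noteq> 0" using z(1) \<mu>(1) n(1) by (auto simp: zero_power)
  have "{..n - 1} = {..<n}" using n(1) by auto
  then have nonzero: "(\<Sum>i<n. z ^ i * (W ^^ i) \<psi> y) \<noteq> 0" using z(2) by (simp add: mult.commute)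
  \<comment> \<open>Applying \<open>z * W\<close> raises every index by one; the new top term
    \<open>z ^ n * (W ^^ n) \<psi>\<close> equals \<open>\<psi>\<close>, the bottom term that was
    lost.\<close>
  have "z * W (\<lambda>x. \<Sum>i<n. z ^ i * (W ^^ i) \<psi> x) x = (\<Sum>i<n. z ^ i * (W ^^ i) \<psi> x)" for x
  proof -
    have "z * W (\<lambda>x. \<Sum>i<n. z ^ i * (W ^^ i) \<psi> x) x = (\<Sum>i<n. z ^ Suc i * (W ^^ Suc i) \<psi> x)"
      by (simp add: W_def weyl_sum sum_distrib_left mult_ac)
    also have "\<dots> = (\<Sum>i<Suc n. z ^ i * (W ^^ i) \<psi> x) - z ^ 0 * (W ^^ 0) \<psi> x"
      by (subst sum.lessThan_Suc_shift) simp
    also have "\<dots> = (\<Sum>i<n. z ^ i * (W ^^ i) \<psi> x)"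
      using \<mu> z(1) by simp
    finally show ?thesis .
  qed
  then have "W (\<lambda>x. \<Sum>i<n. z ^ i * (W ^^ i) \<psi> x) = (\<lambda>x. inverse z * (\<Sum>i<n. z ^ i * (W ^^ i) \<psi> x))"
    using z0 by (auto simp: fun_eq_iff divide_simps mult.commute)
  with nonzero show ?thesis unfolding W_def by blast
qed

text \<open>Induction over the operators: the common eigenvector found so far is replaced by a
  combination of its images under powers of the new operator. The earlier operators commute with
  these powers and keep their eigenvalues.\<close>

lemma commuting_weyl_eigenvector:
  fixes s :: "'k \<Rightarrow> 'g::ab_group_add \<Rightarrow> 'g"
  assumes s: "vector_space s" and P: "finite P"
    and "\<And>\<phi> g. (\<phi>, g) \<in> P \<Longrightarrow> \<phi> \<in> dual s"
    and "\<And>\<phi> g \<phi>' g'. (\<phi>, g) \<in> P \<Longrightarrow> (\<phi>', g') \<in> P \<Longrightarrow> \<phi> g' = \<phi>' g"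
  shows "\<exists>\<psi> y. \<psi> y \<noteq> 0 \<and> (\<forall>\<phi> g. (\<phi>, g) \<in> P \<longrightarrow> (\<exists>\<kappa>. weyl \<chi> \<phi> g \<psi> = (\<lambda>x. \<kappa> * \<psi> x)))"
  using P assms(3,4)
proof (induction rule: finite_induct)
  case empty
  show ?case by (rule exI[of _ "\<lambda>_. 1"]) simp
next
  case (insert p P)
  have "\<exists>\<psi> y. \<psi> y \<noteq> 0 \<and> (\<forall>\<phi> g. (\<phi>, g) \<in> P \<longrightarrow> (\<exists>\<kappa>. weyl \<chi> \<phi> g \<psi> = (\<lambda>x. \<kappa> * \<psi> x)))"
    by (rule insert.IH; rule insert.prems; erule insertI2)
  then obtain \<psi> y where \<psi>: "\<psi> y \<noteq> 0"
    "\<forall>\<phi> g. (\<phi>, g) \<in> P \<longrightarrow> (\<exists>\<kappa>. weyl \<chi> \<phi> g \<psi> = (\<lambda>x. \<kappa> * \<psi> x))"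
    by (elim exE conjE)
  obtain \<phi> g where p: "p = (\<phi>, g)" by fastforce
  then have \<phi>: "\<phi> \<in> dual s" using insert.prems(1)[of \<phi> g] by simp
  obtain c and n :: nat and \<kappa> z where c: "(\<Sum>i<n. c i * (weyl \<chi> \<phi> g ^^ i) \<psi> z) \<noteq> 0"
    "weyl \<chi> \<phi> g (\<lambda>x. \<Sum>i<n. c i * (weyl \<chi> \<phi> g ^^ i) \<psi> x) =
      (\<lambda>x. \<kappa> * (\<Sum>i<n. c i * (weyl \<chi> \<phi> g ^^ i) \<psi> x))"
    using weyl_eigenvector[where \<psi> = \<psi> and g = g, OF s \<phi> \<psi>(1)] by (elim exE conjE)
  have "\<exists>\<kappa>. weyl \<chi> \<phi>' g' (\<lambda>x. \<Sum>i<n. c i * (weyl \<chi> \<phi> g ^^ i) \<psi> x) =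
      (\<lambda>x. \<kappa> * (\<Sum>i<n. c i * (weyl \<chi> \<phi> g ^^ i) \<psi> x))" if P': "(\<phi>', g') \<in> P" for \<phi>' g'
  proof -
    have \<phi>': "\<phi>' \<in> dual s" and "\<phi> g' = \<phi>' g"
      using P' p insert.prems(1)[of \<phi>' g'] insert.prems(2)[of \<phi> g \<phi>' g'] by simp_all
    then have comm: "weyl \<chi> \<phi>' g' (weyl \<chi> \<phi> g f) = weyl \<chi> \<phi> g (weyl \<chi> \<phi>' g' f)" for f
      by (simp add: weyl_comp[OF \<phi>] weyl_comp[OF \<phi>'] add.commute)
    obtain \<kappa> where \<kappa>: "weyl \<chi> \<phi>' g' \<psi> = (\<lambda>x. \<kappa> * \<psi> x)" using \<psi>(2) P' by blast
    have "weyl \<chi> \<phi>' g' ((weyl \<chi> \<phi> g ^^ i) \<psi>) = (\<lambda>x. \<kappa> * (weyl \<chi> \<phi> g ^^ i) \<psi> x)" for i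
      by (induction i) (simp_all add: \<kappa> comm weyl_scale)
    then show ?thesis
      by (intro exI[of _ \<kappa>]) (simp add: weyl_sum sum_distrib_left mult.left_commute)
  qed
  with c(2) have "\<forall>\<phi>' g'. (\<phi>', g') \<in> insert p P \<longrightarrow>
      (\<exists>\<kappa>. weyl \<chi> \<phi>' g' (\<lambda>x. \<Sum>i<n. c i * (weyl \<chi> \<phi> g ^^ i) \<psi> x) =
      (\<lambda>x. \<kappa> * (\<Sum>i<n. c i * (weyl \<chi> \<phi> g ^^ i) \<psi> x)))"
    unfolding p by auto
  with c(1) show ?case by (intro exI conjI)
qed

end

section \<open>Maps into dual spaces and the block operator\<close>

lemma linear_to_dual_mem: "linear_to_dual s1 s2 T \<Longrightarrow> T x \<in> dual s2"
  by (auto simp: linear_to_dual_def)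

lemma linear_to_dual_add: "linear_to_dual s1 s2 T \<Longrightarrow> T (x + y) = T x + T y"
  by (simp add: linear_to_dual_def Vector_Spaces.linear_iff)

lemma linear_to_dual_smult: "linear_to_dual s1 s2 T \<Longrightarrow> T (s1 c x) y = c * T x y"
  by (simp add: linear_to_dual_def Vector_Spaces.linear_iff dual_scale_def)

lemma linear_to_dual_zero: "linear_to_dual s1 s2 T \<Longrightarrow> T 0 = 0"
  using linear_to_dual_add[of s1 s2 T 0 0] by (simp only: add_0_left add_cancel_right_right)

lemma linear_to_dual_uminus: "linear_to_dual s1 s2 T \<Longrightarrow> T (- x) = - T x"
  using linear_to_dual_add[of s1 s2 T x "- x"]
  by (simp only: linear_to_dual_zero add.right_inverse eq_neg_iff_add_eq_0 add.commute)

lemma linear_to_dual_diff: "linear_to_dual s1 s2 T \<Longrightarrow> T (x - y) = T x - T y"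
  using linear_to_dual_add[of s1 s2 T x "- y"] by (simp only: linear_to_dual_uminus add_uminus_conv_diff)

locale graph_operator = character_iso \<chi>
  for \<chi> :: "'k::{field,finite} \<Rightarrow> 'k \<Rightarrow> complex" +
  fixes sH :: "'k \<Rightarrow> 'h::ab_group_add \<Rightarrow> 'h"
    and sF :: "'k \<Rightarrow> 'f::ab_group_add \<Rightarrow> 'f"
    and sG :: "'k \<Rightarrow> 'g::ab_group_add \<Rightarrow> 'g"
    and A :: "'g \<Rightarrow> ('g \<Rightarrow> 'k)"
    and B :: "'h \<Rightarrow> ('g \<Rightarrow> 'k)"
    and C :: "'f \<Rightarrow> ('g \<Rightarrow> 'k)"
    and \<Gamma> :: "'h \<times> 'f \<times> 'g \<Rightarrow> ('h \<times> 'f \<times> 'g \<Rightarrow> 'k)"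
  assumes fin_dim: "fin_dim_space sH" "fin_dim_space sF" "fin_dim_space sG"
    and A: "linear_to_dual sG sG A"
    and B: "linear_to_dual sH sG B"
    and C: "linear_to_dual sF sG C"
    and \<Gamma>_block: "\<Gamma> = block_operator A B C"
    and \<Gamma>_symmetric: "symmetric_operator (prod_scale sH (prod_scale sF sG)) \<Gamma>"
begin

lemma finite_spaces [simp]:
  "finite (UNIV :: 'h set)" "finite (UNIV :: 'f set)" "finite (UNIV :: 'g set)"
  using fin_dim by (blast intro: fin_dim_space_finite)+

lemma \<Gamma>_apply: "\<Gamma> (h, f, g) (h', f', g') = B h' g + C f' g + (B h g' + C f g' + A g g')"
  by (simp add: \<Gamma>_block block_operator_def dual_sum_def dual_adjoint_def)

lemma \<Gamma>_linear:
  "linear_to_dual (prod_scale sH (prod_scale sF sG)) (prod_scale sH (prod_scale sF sG)) \<Gamma>"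
  using \<Gamma>_symmetric by (simp add: symmetric_operator_def)

lemma \<Gamma>_commute: "\<Gamma> u v = \<Gamma> v u"
proof -
  have "dual_adjoint \<Gamma> u v = \<Gamma> u v"
    using \<Gamma>_symmetric by (simp add: symmetric_operator_def)
  then show ?thesis by (simp add: dual_adjoint_def)
qed

lemma A_symmetric: "A x y = A y x"
  using \<Gamma>_commute[of "(0, 0, x)" "(0, 0, y)"]
  by (simp add: \<Gamma>_apply linear_to_dual_zero[OF B] linear_to_dual_zero[OF C]
      dual_zero[OF linear_to_dual_mem[OF B]] dual_zero[OF linear_to_dual_mem[OF C]])

lemmas block_dual [simp] = linear_to_dual_mem[OF A] linear_to_dual_mem[OF B] linear_to_dual_mem[OF C]

lemmas block_zero [simp] = linear_to_dual_zero[OF A] linear_to_dual_zero[OF B] linear_to_dual_zero[OF C]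
  block_dual[THEN dual_zero]

lemmas block_linear = linear_to_dual_add[OF A] linear_to_dual_add[OF B] linear_to_dual_add[OF C]
  linear_to_dual_uminus[OF A] linear_to_dual_uminus[OF B] linear_to_dual_uminus[OF C]
  linear_to_dual_diff[OF A] linear_to_dual_diff[OF B] linear_to_dual_diff[OF C]
  block_dual[THEN dual_add] block_dual[THEN dual_uminus] block_dual[THEN dual_diff]

text \<open>The intersection of the kernels of the adjoints of \<open>B\<close> and
  \<open>C\<close>, written pointwise.\<close>

definition K :: "'g set" where
  "K = {k. (\<forall>h. B h k = 0) \<and> (\<forall>f. C f k = 0)}"

lemma K_diff: "x \<in> K \<Longrightarrow> y \<in> K \<Longrightarrow> x - y \<in> K"
  by (simp add: K_def block_linear)

lemma K_zero [simp]: "0 \<in> K"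
  by (simp add: K_def)

lemma K_uminus: "x \<in> K \<Longrightarrow> - x \<in> K"
  using K_diff[of 0 x] by simp

lemma K_add: "x \<in> K \<Longrightarrow> y \<in> K \<Longrightarrow> x + y \<in> K"
  using K_diff[of x "- y"] K_uminus by simp

lemma finite_K [simp]: "finite K"
  by (rule finite_subset[of _ UNIV]) simp_all

section \<open>Joint eigenspaces and their Weyl translates\<close>

text \<open>The conditions are the eigenvalue equations of \<open>weyl \<chi> (C f) 0\<close> and
  \<open>weyl \<chi> (A k) k\<close>. The eigenvalues are arbitrary functions, so inconsistent
  choices give only the zero function.\<close>

definition joint_eigenspace :: "('f \<Rightarrow> complex) \<Rightarrow> ('g \<Rightarrow> complex) \<Rightarrow> ('g \<Rightarrow> complex) set" where
  "joint_eigenspace \<alpha> \<beta> = {\<psi>.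
     (\<forall>f x. \<epsilon> (C f x) * \<psi> x = \<alpha> f * \<psi> x) \<and>
     (\<forall>k\<in>K. \<forall>x. \<epsilon> (A k x) * \<psi> (x - k) = \<beta> k * \<psi> x)}"

text \<open>The factors in the hypotheses are the commutation phases of
  \<open>weyl \<chi> \<phi> d\<close> with the defining operators. Surjectivity comes from inverting
  \<open>weyl \<chi> \<phi> d\<close>.\<close>

lemma weyl_joint_eigenspace:
  assumes \<phi>: "\<phi> \<in> dual sG"
    and \<alpha>: "\<And>f. \<alpha>' f = \<epsilon> (C f d) * \<alpha> f"
    and \<beta>: "\<And>k. k \<in> K \<Longrightarrow> \<beta>' k = \<epsilon> (A k d - \<phi> k) * \<beta> k"
  shows "weyl \<chi> \<phi> d ` joint_eigenspace \<alpha> \<beta> = joint_eigenspace \<alpha>' \<beta>'"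
proof (intro equalityI subsetI)
  fix \<psi>' assume "\<psi>' \<in> weyl \<chi> \<phi> d ` joint_eigenspace \<alpha> \<beta>"
  then obtain \<psi> where \<psi>: "\<psi> \<in> joint_eigenspace \<alpha> \<beta>" "\<psi>' = (\<lambda>x. \<epsilon> (\<phi> x) * \<psi> (x - d))"
    by (auto simp: weyl_def)
  have "\<epsilon> (C f x) * \<psi>' x = \<alpha>' f * \<psi>' x" for f x
  proof -
    have "\<epsilon> (C f (x - d)) * \<psi> (x - d) = \<alpha> f * \<psi> (x - d)"
      using \<psi>(1) by (simp add: joint_eigenspace_def)
    then have "\<epsilon> (C f x) * \<psi> (x - d) = \<epsilon> (C f d) * \<alpha> f * \<psi> (x - d)"
      by (simp add: block_linear \<epsilon>_diff divide_simps mult_ac)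
    then show ?thesis by (simp add: \<psi>(2) \<alpha> mult.left_commute)
  qed
  moreover have "\<epsilon> (A k x) * \<psi>' (x - k) = \<beta>' k * \<psi>' x" if k: "k \<in> K" for k x
  proof -
    have "\<epsilon> (A k (x - d)) * \<psi> (x - d - k) = \<beta> k * \<psi> (x - d)"
      using \<psi>(1) k by (simp add: joint_eigenspace_def)
    then have "\<epsilon> (A k x) * \<psi> (x - k - d) = \<epsilon> (A k d) * \<beta> k * \<psi> (x - d)"
      by (simp add: block_linear \<epsilon>_diff divide_simps mult_ac diff_diff_add add.commute)
    then show ?thesis
      by (simp add: \<psi>(2) \<beta>[OF k] dual_diff[OF \<phi>] \<epsilon>_diff divide_simps mult_ac)
  qed
  ultimately show "\<psi>' \<in> joint_eigenspace \<alpha>' \<beta>'"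
    by (simp add: joint_eigenspace_def)
next
  fix \<psi>' assume \<psi>': "\<psi>' \<in> joint_eigenspace \<alpha>' \<beta>'"
  \<comment> \<open>The inverse of \<open>weyl \<chi> \<phi> d\<close> applied to
    \<open>\<psi>'\<close>.\<close>
  define \<psi> where "\<psi> = (\<lambda>x. \<epsilon> (- \<phi> (x + d)) * \<psi>' (x + d))"
  have "\<epsilon> (C f x) * \<psi> x = \<alpha> f * \<psi> x" for f x
  proof -
    have "\<epsilon> (C f (x + d)) * \<psi>' (x + d) = \<epsilon> (C f d) * \<alpha> f * \<psi>' (x + d)"
      using \<psi>' by (simp add: joint_eigenspace_def \<alpha>)
    then show ?thesis by (simp add: \<psi>_def block_linear \<epsilon>_add)
  qed
  moreover have "\<epsilon> (A k x) * \<psi> (x - k) = \<beta> k * \<psi> x" if k: "k \<in> K" for k x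
  proof -
    have "\<epsilon> (A k (x + d)) * \<psi>' (x + d - k) = \<epsilon> (A k d - \<phi> k) * \<beta> k * \<psi>' (x + d)"
      using \<psi>' k by (simp add: joint_eigenspace_def \<beta>)
    then have "\<epsilon> (A k x) * \<psi>' (x - k + d) * \<epsilon> (\<phi> k) = \<beta> k * \<psi>' (x + d)"
      by (simp add: block_linear \<epsilon>_diff \<epsilon>_add divide_simps mult_ac algebra_simps)
    then show ?thesis
      by (simp add: \<psi>_def dual_diff[OF \<phi>] dual_add[OF \<phi>] \<epsilon>_diff \<epsilon>_add \<epsilon>_uminus divide_simps mult_ac)
  qed
  moreover have "\<psi>' = weyl \<chi> \<phi> d \<psi>"
    by (simp add: weyl_def \<psi>_def \<epsilon>_uminus fun_eq_iff)
  ultimately show "\<psi>' \<in> weyl \<chi> \<phi> d ` joint_eigenspace \<alpha> \<beta>"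
    by (auto simp: joint_eigenspace_def)
qed

section \<open>The isotropic subspace and its stabilizer codes\<close>

definition S :: "(('g \<Rightarrow> 'k) \<times> 'g) set" where
  "S = {(A k + t, k) | k t. k \<in> K \<and> t \<in> range C}"

lemma mem_S: "k \<in> K \<Longrightarrow> (A k + C f, k) \<in> S"
  by (auto simp: S_def)

lemma mem_S_A: "k \<in> K \<Longrightarrow> (A k, k) \<in> S"
  using mem_S[of k 0] by simp

lemma mem_S_C: "(C f, 0) \<in> S"
  using mem_S[of 0 f] by simp

text \<open>In the symplectic form the two \<open>A\<close> terms cancel by symmetry, and the
  \<open>C\<close> terms vanish because they are evaluated on \<open>K\<close>.\<close>

lemma S_isotropic: "isotropic sG S"
proof -
  have vs: "vector_space sG" by (simp add: fin_dim fin_dim_space_vector_space)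
  interpret G: vector_space sG by fact
  interpret D: module "prod_scale dual_scale sG :: 'k \<Rightarrow> ('g \<Rightarrow> 'k) \<times> 'g \<Rightarrow> ('g \<Rightarrow> 'k) \<times> 'g"
    by unfold_locales
      (auto simp: prod_scale_def dual_scale_def fun_eq_iff algebra_simps G.scale_left_distrib
        G.scale_right_distrib)
  have "S \<subseteq> dual sG \<times> UNIV"
    by (auto simp: S_def mem_dual_iff[OF vs] block_linear dual_smult[OF block_dual(1)] dual_smult[OF block_dual(3)]
        algebra_simps)
  moreover have "D.subspace S"
  proof (rule D.subspaceI)
    show "0 \<in> S" using mem_S_C[of 0] by (simp add: zero_prod_def)
  next
    fix x y assume "x \<in> S" "y \<in> S"
    then obtain k f k' f' where "x = (A k + C f, k)" "y = (A k' + C f', k')" "k \<in> K" "k' \<in> K"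
      by (auto simp: S_def)
    then show "x + y \<in> S"
      using mem_S[OF K_add, of k k' "f + f'"] by (simp add: block_linear add_ac)
  next
    fix c x assume "x \<in> S"
    then obtain k f where x: "x = (A k + C f, k)" "k \<in> K"
      by (auto simp: S_def)
    have "sG c k \<in> K"
      using x(2) by (simp add: K_def dual_smult[OF block_dual(2)] dual_smult[OF block_dual(3)])
    moreover have "prod_scale dual_scale sG c x = (A (sG c k) + C (sF c f), sG c k)"
      by (simp add: x prod_scale_def dual_scale_def fun_eq_iff linear_to_dual_smult[OF A]
          linear_to_dual_smult[OF C] algebra_simps)
    ultimately show "prod_scale dual_scale sG c x \<in> S"
      using mem_S by simp
  qed
  moreover have "\<phi>0 g1 - \<phi>1 g0 = 0" if S: "(\<phi>0, g0) \<in> S" "(\<phi>1, g1) \<in> S" for \<phi>0 g0 \<phi>1 g1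
  proof -
    obtain f0 f1 where "\<phi>0 = A g0 + C f0" "\<phi>1 = A g1 + C f1" "g0 \<in> K" "g1 \<in> K"
      using S by (auto simp: S_def)
    then show ?thesis by (simp add: K_def A_symmetric)
  qed
  ultimately show ?thesis
    by (auto simp: isotropic_def)
qed

text \<open>Every generator splits as \<open>weyl \<chi> (C f) 0\<close> after
  \<open>weyl \<chi> (A k) k\<close>, without a phase since the outer factor has shift 0. The
  equations for these two families therefore suffice.\<close>

lemma eigenspace_S:
  assumes \<zeta>: "algebra_character (weyl_algebra \<chi> S) \<zeta>"
  shows "eigenspace \<chi> S \<zeta> =
    joint_eigenspace (\<lambda>f. \<zeta> (weyl \<chi> (C f) 0)) (\<lambda>k. \<zeta> (weyl \<chi> (A k) k))"
proof -
  have gen: "(weyl \<chi> (A k) k \<psi> = (\<lambda>x. c * \<psi> x)) \<longleftrightarrow> (\<forall>x. \<epsilon> (A k x) * \<psi> (x - k) = c * \<psi> x)"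
    "(weyl \<chi> (C f) 0 \<psi> = (\<lambda>x. c * \<psi> x)) \<longleftrightarrow> (\<forall>x. \<epsilon> (C f x) * \<psi> x = c * \<psi> x)" for k f \<psi> c
    by (auto simp: weyl_def fun_eq_iff)
  have "weyl \<chi> (A k + C f) k \<psi> = (\<lambda>x. \<zeta> (weyl \<chi> (A k + C f) k) * \<psi> x)"
    if k: "k \<in> K" and \<psi>: "weyl \<chi> (A k) k \<psi> = (\<lambda>x. \<zeta> (weyl \<chi> (A k) k) * \<psi> x)"
      "weyl \<chi> (C f) 0 \<psi> = (\<lambda>x. \<zeta> (weyl \<chi> (C f) 0) * \<psi> x)" for k f \<psi>
  proof -
    have "weyl \<chi> (A k + C f) k \<psi> = weyl \<chi> (C f) 0 (weyl \<chi> (A k) k \<psi>)"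
      by (simp add: weyl_comp[OF block_dual(1)] add.commute)
    also have "\<dots> = (\<lambda>x. \<zeta> (weyl \<chi> (A k) k) * (\<zeta> (weyl \<chi> (C f) 0) * \<psi> x))"
      by (simp only: \<psi> weyl_scale)
    also have "\<zeta> (weyl \<chi> (C f) 0) * \<zeta> (weyl \<chi> (A k) k) = \<zeta> (weyl \<chi> (A k + C f) k)"
      using algebra_character_weyl_comp[OF \<zeta> mem_S_C[of f] mem_S_A[OF k] _ block_dual(1)] mem_S[OF k]
      by (simp add: add.commute)
    then have "(\<lambda>x. \<zeta> (weyl \<chi> (A k) k) * (\<zeta> (weyl \<chi> (C f) 0) * \<psi> x)) =
        (\<lambda>x. \<zeta> (weyl \<chi> (A k + C f) k) * \<psi> x)"
      by (metis mult.assoc mult.commute)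
    finally show ?thesis .
  qed
  then show ?thesis
    unfolding eigenspace_eq_generators[OF \<zeta>] joint_eigenspace_def gen[symmetric]
    using mem_S_A mem_S_C by (fastforce simp: S_def)
qed

section \<open>Protected subspaces of graph codes\<close>

text \<open>The graph of \<open>\<Gamma>\<close> is closed under addition, so the composition law of
  Weyl operators passes to \<open>\<tau>\<close>. These two equations are all that later arguments
  use about \<open>\<tau>\<close>.\<close>

lemma graph_character:
  assumes \<zeta>: "algebra_character (weyl_algebra \<chi> (graph_subspace \<Gamma>)) \<zeta>"
  defines "\<tau> \<equiv> \<lambda>v. \<zeta> (weyl \<chi> (\<Gamma> v) v)"
  shows "\<tau> (u + v) = \<epsilon> (\<Gamma> v u) * \<tau> u * \<tau> v" and "\<tau> 0 = 1"
proof -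
  have mem: "(\<Gamma> v, v) \<in> graph_subspace \<Gamma>" for v unfolding graph_subspace_def by blast
  have "\<tau> u * \<tau> v = \<epsilon> (- \<Gamma> v u) * \<tau> (u + v)"
    unfolding \<tau>_def linear_to_dual_add[OF \<Gamma>_linear]
    using mem[of "u + v"]
    by (intro algebra_character_weyl_comp[OF \<zeta> mem mem _ linear_to_dual_mem[OF \<Gamma>_linear]])
      (simp only: linear_to_dual_add[OF \<Gamma>_linear])
  then show "\<tau> (u + v) = \<epsilon> (\<Gamma> v u) * \<tau> u * \<tau> v"
    by (simp add: \<epsilon>_uminus divide_simps mult_ac)
  show "\<tau> 0 = 1"
    using \<zeta> by (simp add: \<tau>_def linear_to_dual_zero[OF \<Gamma>_linear] weyl_zero algebra_character_def)
qed

text \<open>All normalizations are collected in one nonzero constant independent of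
  \<open>\<tau>\<close>, which does not affect the image.\<close>

lemma graph_code_eq:
  "\<exists>N. N \<noteq> 0 \<and> (\<forall>\<tau>. graph_code \<tau> = (UNIV, \<lambda>(\<psi> :: 'h \<Rightarrow> complex) (g :: 'g).
     N * (\<Sum>h\<in>UNIV. \<Sum>f\<in>(UNIV :: 'f set). \<tau> (h, f, g) * \<psi> h)))"
  by (rule exI[of _ "complex_of_real (sqrt (real (card (UNIV :: 'h set)) * real (card (UNIV :: 'f set))))
      / (of_nat (card (UNIV :: 'h set)) * of_nat (card (UNIV :: 'f set)))"])
    (simp add: graph_code_def haar_integral_def sum_divide_distrib sum_distrib_left mult_ac divide_simps)

lemma sum_\<epsilon>_B:
  "(\<Sum>h\<in>UNIV. \<epsilon> (B h x)) = (if \<forall>h. B h x = 0 then of_nat (card (UNIV :: 'h set)) else 0)"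
proof (cases "\<forall>h. B h x = 0")
  case False
  then obtain h where "B h x \<noteq> 0" by blast
  then obtain c where "\<epsilon> (c * B h x) \<noteq> 1" using \<epsilon>_mult_nontrivial by blast
  then have "\<epsilon> (B (sH c h) x) \<noteq> 1" by (simp add: linear_to_dual_smult[OF B])
  then have "(\<Sum>h\<in>UNIV. \<epsilon> (B h x)) = 0"
    by (intro sum_nontrivial_character[of _ "sH c h"]) (simp_all add: block_linear \<epsilon>_add)
  with False show ?thesis by simp
qed simp

text \<open>One inclusion follows from the factorization of \<open>\<tau>\<close>. For the other,
  \<open>\<Phi> / G\<close> is constant on cosets of \<open>K\<close> within the support coset, so
  inverting the Fourier sum over \<open>h\<close> recovers it.\<close>

lemma protected_subspace_graph_code:
  assumes \<tau>_add: "\<And>u v. \<tau> (u + v) = \<epsilon> (\<Gamma> v u) * \<tau> u * \<tau> v" and \<tau>_zero: "\<tau> 0 = 1"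
  shows "protected_subspace (graph_code \<tau>) =
    joint_eigenspace (\<lambda>f. inverse (\<tau> (0, f, 0))) (\<lambda>k. \<tau> (0, 0, - k))"
proof (intro equalityI subsetI)
  define H where "H h = \<tau> (h, 0, 0)" for h
  define F where "F f = \<tau> (0, f, 0)" for f
  define G where "G g = \<tau> (0, 0, g)" for g
  have nz: "\<tau> v \<noteq> 0" for v
    using \<tau>_add[of v "- v"] \<tau>_zero by auto
  \<comment> \<open>The zero blocks of \<open>\<Gamma>\<close> leave no phase coupling
    \<open>h\<close> to \<open>f\<close>, so the sums over \<open>h\<close> and \<open>f\<close>
    separate in \<open>code_apply\<close>.\<close>
  have \<tau>: "\<tau> (h, f, g) = H h * \<epsilon> (B h g) * (F f * \<epsilon> (C f g)) * G g" for h f g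
    using \<tau>_add[of "(h, 0, 0)" "(0, f, 0)"] \<tau>_add[of "(h, f, 0)" "(0, 0, g)"]
    by (simp add: H_def F_def G_def \<Gamma>_apply \<epsilon>_add mult_ac)
  have F_add: "F (f + f') = F f * F f'" for f f'
    using \<tau>_add[of "(0, f, 0)" "(0, f', 0)"] by (simp add: F_def \<Gamma>_apply)
  have G_diff: "G (x - k) = G x * G (- k) / \<epsilon> (A k x)" for x k
    using \<tau>_add[of "(0, 0, x)" "(0, 0, - k)"]
    by (simp add: G_def \<Gamma>_apply block_linear \<epsilon>_uminus divide_simps mult_ac)
  have nonzero [simp]: "H h \<noteq> 0" "F f \<noteq> 0" "G g \<noteq> 0" for h f g
    using nz by (auto simp: H_def F_def G_def)
  obtain N where N: "N \<noteq> 0" and code: "graph_code \<tau> = (UNIV, \<lambda>(\<psi> :: 'h \<Rightarrow> complex) (g :: 'g).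
     N * (\<Sum>h\<in>UNIV. \<Sum>f\<in>(UNIV :: 'f set). \<tau> (h, f, g) * \<psi> h))"
    using graph_code_eq by blast
  have code_apply: "snd (graph_code \<tau>) \<psi> g =
      N * G g * (\<Sum>f\<in>UNIV. F f * \<epsilon> (C f g)) * (\<Sum>h\<in>UNIV. H h * \<epsilon> (B h g) * \<psi> h)" for \<psi> g
    by (subst mult.assoc, subst (2) mult.commute)
      (simp add: code \<tau> sum_product sum_distrib_left mult_ac)
  have image: "protected_subspace (graph_code \<tau>) = range (snd (graph_code \<tau>))"
    by (simp add: protected_subspace_def code)
  {
    fix \<Phi> assume "\<Phi> \<in> protected_subspace (graph_code \<tau>)"
    then obtain \<psi> where \<Phi>: "\<Phi> = snd (graph_code \<tau>) \<psi>"
      by (auto simp: image)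
    have shift: "\<epsilon> (C f x) * F f * (\<Sum>f'\<in>UNIV. F f' * \<epsilon> (C f' x)) = (\<Sum>f'\<in>UNIV. F f' * \<epsilon> (C f' x))" for f x
    proof -
      have "\<epsilon> (C f x) * F f * (\<Sum>f'\<in>UNIV. F f' * \<epsilon> (C f' x)) =
          (\<Sum>f'\<in>UNIV. F (f + f') * \<epsilon> (C (f + f') x))"
        by (simp add: sum_distrib_left F_add block_linear \<epsilon>_add mult_ac)
      also have "\<dots> = (\<Sum>f'\<in>UNIV. F f' * \<epsilon> (C f' x))"
        by (rule sum.reindex_bij_witness[of _ "\<lambda>y. y - f" "\<lambda>y. f + y"]) auto
      finally show ?thesis .
    qed
    have invariant: "\<epsilon> (C f x) * F f * \<Phi> x = \<Phi> x" for f x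
    proof -
      have "\<epsilon> (C f x) * F f * \<Phi> x = N * G x *
          (\<epsilon> (C f x) * F f * (\<Sum>f'\<in>UNIV. F f' * \<epsilon> (C f' x))) * (\<Sum>h\<in>UNIV. H h * \<epsilon> (B h x) * \<psi> h)"
        by (simp only: \<Phi> code_apply mult_ac)
      then show ?thesis by (simp only: shift \<Phi> code_apply)
    qed
    have "\<epsilon> (C f x) * \<Phi> x = inverse (F f) * \<Phi> x" for f x
    proof -
      have "inverse (F f) * \<Phi> x = inverse (F f) * (\<epsilon> (C f x) * F f * \<Phi> x)"
        by (simp only: invariant)
      also have "\<dots> = \<epsilon> (C f x) * \<Phi> x"
        by simp
      finally show ?thesis ..
    qed
    \<comment> \<open>A shift by \<open>k \<in> K\<close> changes neither \<open>B h x\<close> nor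
      \<open>C f x\<close>; only the factor \<open>G\<close> reacts.\<close>
    moreover have "\<epsilon> (A k x) * \<Phi> (x - k) = G (- k) * \<Phi> x" if "k \<in> K" for k x
      using that by (simp add: \<Phi> code_apply G_diff block_linear K_def)
    ultimately show "\<Phi> \<in> joint_eigenspace (\<lambda>f. inverse (\<tau> (0, f, 0))) (\<lambda>k. \<tau> (0, 0, - k))"
      by (simp add: joint_eigenspace_def F_def G_def)
  next
    fix \<Phi> assume "\<Phi> \<in> joint_eigenspace (\<lambda>f. inverse (\<tau> (0, f, 0))) (\<lambda>k. \<tau> (0, 0, - k))"
    then have \<Phi>C: "\<epsilon> (C f x) * \<Phi> x = inverse (F f) * \<Phi> x"
      and \<Phi>A: "k \<in> K \<Longrightarrow> \<epsilon> (A k x) * \<Phi> (x - k) = G (- k) * \<Phi> x" for f k x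
      by (auto simp: joint_eigenspace_def F_def G_def)
    \<comment> \<open>The cardinalities are the values of the surviving sums over \<open>f\<close>,
      \<open>h\<close> and the coset of \<open>K\<close>.\<close>
    define M :: complex where
      "M = N * of_nat (card (UNIV :: 'f set)) * of_nat (card (UNIV :: 'h set)) * of_nat (card K)"
    have "K \<noteq> {}" using K_zero by blast
    then have "M \<noteq> 0" by (simp add: M_def N)
    \<comment> \<open>The inverse Fourier transform of \<open>\<Phi> / G\<close> along
      \<open>B\<close>; dividing by \<open>H h\<close> cancels the restriction of
      \<open>\<tau>\<close> to \<open>H\<close>.\<close>
    define \<psi> where "\<psi> h = (\<Sum>y\<in>UNIV. \<epsilon> (- B h y) * (\<Phi> y / G y)) / (M * H h)" for h
    have "snd (graph_code \<tau>) \<psi> g = \<Phi> g" for g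
    \<comment> \<open>Outside the support coset both sides vanish: the sum over \<open>f\<close> is
      that of a nontrivial character.\<close>
    proof (cases "\<forall>f. F f * \<epsilon> (C f g) = 1")
      case False
      then obtain f where f: "F f * \<epsilon> (C f g) \<noteq> 1" by blast
      have "(\<Sum>f\<in>UNIV. F f * \<epsilon> (C f g)) = 0"
        by (rule sum_nontrivial_character[of _ f]) (use f in \<open>simp_all add: F_add block_linear \<epsilon>_add mult_ac\<close>)
      moreover have "\<Phi> g = 0"
        using \<Phi>C[of f g] f by (auto simp: divide_simps mult_ac)
      ultimately show ?thesis by (simp add: code_apply)
    next
      case True
      have summand: "(\<Sum>h\<in>UNIV. \<epsilon> (B h (g - y))) * (\<Phi> y / G y) =
          (if g - y \<in> K then of_nat (card (UNIV :: 'h set)) * (\<Phi> g / G g) else 0)" for y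
      proof (cases "\<Phi> y = 0 \<or> \<not> (\<forall>h. B h (g - y) = 0)")
        case zero: True
        have "\<Phi> g = 0" if "g - y \<in> K"
          using zero \<Phi>A[OF that, of g] that by (auto simp: K_def)
        with zero show ?thesis by (auto simp: sum_\<epsilon>_B K_def)
      next
        case nonzero: False
        \<comment> \<open>Both points give the phase \<open>inverse (F f)\<close> for every
          \<open>f\<close>: \<open>g\<close> by the case assumption, \<open>y\<close> because
          \<open>\<Phi> y \<noteq> 0\<close>. Rescaling \<open>f\<close> excludes a nonzero
          difference.\<close>
        have "C f (g - y) = 0" for f
        proof (rule ccontr)
          assume "C f (g - y) \<noteq> 0"
          then obtain c where "\<epsilon> (c * C f (g - y)) \<noteq> 1" using \<epsilon>_mult_nontrivial by blast
          then have "\<epsilon> (C (sF c f) (g - y)) \<noteq> 1" by (simp add: linear_to_dual_smult[OF C])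
          moreover have "\<epsilon> (C (sF c f) y) = inverse (F (sF c f))"
            using \<Phi>C[of "sF c f" y] nonzero by simp
          moreover have "\<epsilon> (C (sF c f) g) = inverse (F (sF c f))"
            using True by (metis inverse_unique)
          ultimately show False by (simp add: block_linear \<epsilon>_diff)
        qed
        then have K: "g - y \<in> K" using nonzero by (simp add: K_def)
        have "\<Phi> y = G (- (g - y)) * \<Phi> g / \<epsilon> (A (g - y) g)"
          using \<Phi>A[OF K, of g] by (simp add: divide_simps mult_ac)
        moreover have "G y = G g * G (- (g - y)) / \<epsilon> (A (g - y) g)"
          using G_diff[of g "g - y"] by simp
        ultimately have "\<Phi> y / G y = \<Phi> g / G g"
          by simp
        then show ?thesis using K nonzero by (simp add: sum_\<epsilon>_B)
      qed
      have "card {y. g - y \<in> K} = card K"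
        by (rule bij_betw_same_card[of "\<lambda>y. g - y"], rule bij_betw_byWitness[of _ "\<lambda>y. g - y"]) auto
      then have "(\<Sum>y\<in>UNIV. (\<Sum>h\<in>UNIV. \<epsilon> (B h (g - y))) * (\<Phi> y / G y)) =
          of_nat (card K) * of_nat (card (UNIV :: 'h set)) * (\<Phi> g / G g)"
        unfolding summand by (simp add: sum.If_cases mult_ac)
      moreover have "(\<Sum>h\<in>UNIV. H h * \<epsilon> (B h g) * \<psi> h) =
          (\<Sum>y\<in>UNIV. (\<Sum>h\<in>UNIV. \<epsilon> (B h (g - y))) * (\<Phi> y / G y)) / M"
      proof -
        have "(\<Sum>h\<in>UNIV. H h * \<epsilon> (B h g) * \<psi> h) =
            (\<Sum>h\<in>UNIV. \<Sum>y\<in>UNIV. \<epsilon> (B h (g - y)) * (\<Phi> y / G y) / M)"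
        proof (rule sum.cong[OF refl])
          fix h
          have "H h * \<epsilon> (B h g) * \<psi> h = \<epsilon> (B h g) * (\<Sum>y\<in>UNIV. \<epsilon> (- B h y) * (\<Phi> y / G y)) / M"
            by (simp add: \<psi>_def)
          also have "\<dots> = (\<Sum>y\<in>UNIV. \<epsilon> (B h (g - y)) * (\<Phi> y / G y) / M)"
            by (simp add: sum_distrib_left sum_divide_distrib block_linear \<epsilon>_diff \<epsilon>_uminus divide_inverse mult_ac)
          finally show "H h * \<epsilon> (B h g) * \<psi> h = (\<Sum>y\<in>UNIV. \<epsilon> (B h (g - y)) * (\<Phi> y / G y) / M)" .
        qed
        also have "\<dots> = (\<Sum>y\<in>UNIV. (\<Sum>h\<in>UNIV. \<epsilon> (B h (g - y))) * (\<Phi> y / G y)) / M"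
          by (subst sum.swap) (simp add: sum_divide_distrib sum_distrib_right)
        finally show ?thesis .
      qed
      moreover have "(\<Sum>f\<in>UNIV. F f * \<epsilon> (C f g)) = of_nat (card (UNIV :: 'f set))"
        using True by simp
      ultimately have "snd (graph_code \<tau>) \<psi> g = N * G g * of_nat (card (UNIV :: 'f set)) *
          (of_nat (card K) * of_nat (card (UNIV :: 'h set)) * (\<Phi> g / G g) / M)"
        by (simp only: code_apply)
      also have "\<dots> = \<Phi> g * M / M"
        by (simp add: M_def mult_ac)
      finally show ?thesis using \<open>M \<noteq> 0\<close> by simp
    qed
    then show "\<Phi> \<in> protected_subspace (graph_code \<tau>)"
      by (metis (no_types) image ext rangeI)
  }
qed

section \<open>Existence of a nonzero graph code\<close>

text \<open>Symmetry of \<open>A\<close> makes the operators \<open>weyl \<chi> (A x) x\<close>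
  commute. Their eigenvalues on a common eigenvector inherit the composition law.\<close>

lemma ex_quadratic_phase:
  "\<exists>q. (\<forall>x y. q (x + y) = \<epsilon> (A y x) * q x * q y) \<and> q 0 = 1"
proof -
  have vs: "vector_space sG" by (simp add: fin_dim fin_dim_space_vector_space)
  have "finite (range (\<lambda>x. (A x, x)))" by simp
  then have "\<exists>\<psi> y. \<psi> y \<noteq> 0 \<and> (\<forall>\<phi> g. (\<phi>, g) \<in> range (\<lambda>x. (A x, x)) \<longrightarrow>
      (\<exists>\<kappa>. weyl \<chi> \<phi> g \<psi> = (\<lambda>x. \<kappa> * \<psi> x)))"
    by (rule commuting_weyl_eigenvector[OF vs]) (auto simp: A_symmetric)
  then obtain \<psi> y where \<psi>: "\<psi> y \<noteq> 0" and "\<And>x. \<exists>\<kappa>. weyl \<chi> (A x) x \<psi> = (\<lambda>z. \<kappa> * \<psi> z)"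
    by auto
  then obtain q where q: "\<And>x. weyl \<chi> (A x) x \<psi> = (\<lambda>z. q x * \<psi> z)"
    by metis
  have "q (x + z) = \<epsilon> (A z x) * q x * q z" for x z
  proof -
    have "weyl \<chi> (A x) x (weyl \<chi> (A z) z \<psi>) y = \<epsilon> (- A z x) * weyl \<chi> (A (x + z)) (x + z) \<psi> y"
      by (simp add: weyl_comp[OF block_dual(1)] linear_to_dual_add[OF A])
    then have "q z * (q x * \<psi> y) = \<epsilon> (- A z x) * (q (x + z) * \<psi> y)"
      by (simp only: q weyl_scale)
    then show ?thesis using \<psi> by (simp add: \<epsilon>_uminus divide_simps mult_ac)
  qed
  moreover have "q 0 = 1"
    using fun_cong[OF q[of 0], of y] \<psi> by (simp add: weyl_zero)
  ultimately show ?thesis by blast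
qed

lemma ex_nonzero_graph_code:
  "\<exists>c :: ('h \<Rightarrow> complex, 'g) code. is_graph_code \<chi> \<Gamma> c \<and> protected_subspace c \<noteq> {0}"
proof -
  obtain q where q: "\<And>x y. q (x + y) = \<epsilon> (A y x) * q x * q y" "q 0 = 1"
    using ex_quadratic_phase by blast
  \<comment> \<open>This choice is trivial on \<open>F\<close>, so the sum over \<open>f\<close>
    does not cancel at \<open>g = 0\<close>.\<close>
  define \<tau> where "\<tau> = (\<lambda>(h, f, g). \<epsilon> (B h g + C f g) * q g)"
  have \<tau>_add: "\<tau> (u + v) = \<epsilon> (\<Gamma> v u) * \<tau> u * \<tau> v" for u v
    by (cases u; cases v) (simp add: \<tau>_def \<Gamma>_apply q block_linear \<epsilon>_add mult_ac)
  have \<tau>_zero: "\<tau> 0 = 1" by (simp add: \<tau>_def zero_prod_def q)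
  \<comment> \<open>The reflection of \<open>\<tau>\<close> is a common eigenvector of all
    \<open>weyl \<chi> (\<Gamma> v) v\<close> with eigenvalues \<open>\<tau> v\<close>, so
    \<open>\<tau>\<close> comes from a character of the algebra.\<close>
  define \<psi> where "\<psi> v = \<tau> (- v)" for v
  have eig: "weyl \<chi> (\<Gamma> v) v \<psi> = (\<lambda>x. \<tau> v * \<psi> x)" for v
  proof
    fix x
    have "\<psi> (x - v) = inverse (\<epsilon> (\<Gamma> v x)) * \<tau> v * \<psi> x"
      using \<tau>_add[of v "- x"]
      by (simp add: \<psi>_def linear_to_dual_uminus[OF \<Gamma>_linear] \<Gamma>_commute[of x] \<epsilon>_uminus)
    then show "weyl \<chi> (\<Gamma> v) v \<psi> x = \<tau> v * \<psi> x"
      by (simp add: weyl_def)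
  qed
  have \<psi>_zero: "\<psi> 0 = 1" by (simp only: \<psi>_def minus_zero \<tau>_zero)
  define \<zeta> :: "('h \<times> 'f \<times> 'g) op \<Rightarrow> complex" where "\<zeta> = (\<lambda>a. a \<psi> 0 / \<psi> 0)"
  have "algebra_character (weyl_algebra \<chi> (graph_subspace \<Gamma>)) \<zeta>"
    unfolding \<zeta>_def
    by (rule algebra_character_of_eigenvector[where \<kappa> = "\<lambda>_. \<tau>"])
      (auto simp: graph_subspace_def eig \<psi>_zero simp del: split_paired_Ex)
  moreover have "graph_code \<tau> = graph_code (\<lambda>v. \<zeta> (weyl \<chi> (\<Gamma> v) v))"
    by (simp add: \<zeta>_def eig \<psi>_zero)
  ultimately have "is_graph_code \<chi> \<Gamma> (graph_code \<tau>)"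
    unfolding is_graph_code_def by blast
  moreover have "protected_subspace (graph_code \<tau>) \<noteq> {0}"
  proof
    assume trivial: "protected_subspace (graph_code \<tau>) = {0}"
    obtain N where N: "N \<noteq> 0" and code: "graph_code \<tau> = (UNIV, \<lambda>(\<psi> :: 'h \<Rightarrow> complex) (g :: 'g).
       N * (\<Sum>h\<in>UNIV. \<Sum>f\<in>(UNIV :: 'f set). \<tau> (h, f, g) * \<psi> h))"
      using graph_code_eq by blast
    \<comment> \<open>Concentrating the input at \<open>h = 0\<close> leaves at \<open>g = 0\<close>
      a positive count of the elements of \<open>F\<close>, up to the factor
      \<open>N\<close>.\<close>
    define \<delta> :: "'h \<Rightarrow> complex" where "\<delta> h = (if h = 0 then 1 else 0)" for h
    have "snd (graph_code \<tau>) \<delta> \<in> protected_subspace (graph_code \<tau>)"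
      by (simp add: protected_subspace_def code)
    then have "snd (graph_code \<tau>) \<delta> 0 = 0"
      by (simp add: trivial)
    moreover have "(\<Sum>h\<in>UNIV. \<Sum>f\<in>UNIV. \<tau> (h, f, 0) * \<delta> h) =
        (\<Sum>h\<in>(UNIV :: 'h set). if h = 0 then of_nat (card (UNIV :: 'f set)) else 0)"
      by (rule sum.cong[OF refl]) (simp add: \<tau>_def \<delta>_def q)
    ultimately show False using N by (simp add: code)
  qed
  ultimately show ?thesis by blast
qed

section \<open>Matching the eigenvalues of the two codes\<close>

text \<open>The shift \<open>d\<close> is chosen first, to match the eigenvalues indexed by
  \<open>F\<close>; the functional \<open>\<phi>\<close> then corrects those indexed by
  \<open>K\<close> and leaves the former untouched.\<close>

lemma nonzero_graph_code_equivalent: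
  fixes c :: "('h \<Rightarrow> complex, 'g) code"
  assumes "is_graph_code \<chi> \<Gamma> c" and nonzero: "protected_subspace c \<noteq> {0}"
    and "is_stabilizer_code \<chi> S c'"
  shows "equivalent_codes \<chi> sG c c'"
proof -
  obtain \<zeta> where \<zeta>: "algebra_character (weyl_algebra \<chi> (graph_subspace \<Gamma>)) \<zeta>"
    and c: "c = graph_code (\<lambda>v. \<zeta> (weyl \<chi> (\<Gamma> v) v))"
    using assms(1) by (auto simp: is_graph_code_def)
  define \<tau> where "\<tau> v = \<zeta> (weyl \<chi> (\<Gamma> v) v)" for v
  have \<tau>_add: "\<tau> (u + v) = \<epsilon> (\<Gamma> v u) * \<tau> u * \<tau> v" and \<tau>_zero: "\<tau> 0 = 1" for u v
    unfolding \<tau>_def by (rule graph_character[OF \<zeta>])+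
  obtain \<zeta>' where \<zeta>': "algebra_character (weyl_algebra \<chi> S) \<zeta>'" and c': "c' = stabilizer_code \<chi> S \<zeta>'"
    using assms(3) by (auto simp: is_stabilizer_code_def)
  define \<alpha> \<beta> where "\<alpha> f = inverse (\<tau> (0, f, 0))" and "\<beta> k = \<tau> (0, 0, - k)" for f k
  \<comment> \<open>Taken on functionals instead of \<open>F\<close>: elements of
    \<open>range C\<close> are separated by points of \<open>G\<close>, whereas \<open>C\<close> may
    have a kernel.\<close>
  define \<sigma> where "\<sigma> t = \<zeta>' (weyl \<chi> t 0)" for t
  define \<beta>' where "\<beta>' = (\<lambda>k. \<zeta>' (weyl \<chi> (A k) k))"
  have graph: "protected_subspace c = joint_eigenspace \<alpha> \<beta>"
    using protected_subspace_graph_code[of \<tau>, OF \<tau>_add \<tau>_zero] unfolding c \<alpha>_def \<beta>_def \<tau>_def .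
  have stabilizer: "protected_subspace c' = joint_eigenspace (\<lambda>f. \<sigma> (C f)) \<beta>'"
    using eigenspace_S[OF \<zeta>']
    by (simp add: c' stabilizer_code_def protected_subspace_def \<sigma>_def \<beta>'_def)

  have "0 \<in> joint_eigenspace \<alpha> \<beta>"
    by (simp add: joint_eigenspace_def)
  then obtain \<Phi> where \<Phi>: "\<Phi> \<in> joint_eigenspace \<alpha> \<beta>" "\<Phi> \<noteq> 0"
    using nonzero graph by blast
  then obtain x where x: "\<Phi> x \<noteq> 0" by (auto simp: fun_eq_iff)
  \<comment> \<open>Here nonvanishing of the code enters: at a point of the support the eigenvalue
    equation can be divided by \<open>\<Phi> x\<close>.\<close>
  then have \<alpha>: "\<alpha> f = \<epsilon> (C f x)" for f
    using \<Phi>(1) by (simp add: joint_eigenspace_def) (metis x)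

  have \<zeta>'_id: "\<zeta>' (weyl \<chi> 0 0) = 1"
    using \<zeta>' by (simp add: weyl_zero algebra_character_def)
  have \<sigma>_add: "\<sigma> (C f + C f') = \<sigma> (C f) * \<sigma> (C f')" for f f'
    using algebra_character_weyl_comp[OF \<zeta>' mem_S_C[of f] mem_S_C[of f'] _ block_dual(3)]
      mem_S_C[of "f + f'"]
    by (simp add: \<sigma>_def block_linear)
  have "\<exists>y\<in>UNIV. \<forall>t\<in>range C. \<sigma> t = \<epsilon> (t y)"
  proof (rule character_eq_pairing)
    show "0 \<in> range C" by (rule range_eqI[of _ _ 0]) simp
    show "s - t \<in> range C" if "s \<in> range C" "t \<in> range C" for s t
      using that by (auto simp flip: linear_to_dual_diff[OF C])
    show "\<exists>y\<in>UNIV. \<epsilon> (t y) \<noteq> 1" if t: "t \<in> range C" "t \<noteq> 0" for t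
    proof -
      obtain y where "t y \<noteq> 0" using t(2) by (auto simp: fun_eq_iff)
      then obtain a where "\<epsilon> (a * t y) \<noteq> 1" using \<epsilon>_mult_nontrivial by blast
      moreover have "t (sG a y) = a * t y" using t(1) by (auto simp: dual_smult[OF block_dual(3)])
      ultimately show ?thesis by (metis UNIV_I)
    qed
  qed (auto simp: block_linear \<epsilon>_add \<sigma>_add \<sigma>_def[of 0] \<zeta>'_id)
  then obtain y where y: "\<sigma> (C f) = \<epsilon> (C f y)" for f by blast
  define d where "d = y - x"
  have \<alpha>': "\<sigma> (C f) = \<epsilon> (C f d) * \<alpha> f" for f
    by (simp add: y \<alpha> d_def block_linear \<epsilon>_diff)

  have \<beta>_add: "\<beta> (k + l) = \<epsilon> (A l k) * \<beta> k * \<beta> l" for k l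
    using \<tau>_add[of "(0, 0, - k)" "(0, 0, - l)"] by (simp add: \<beta>_def \<Gamma>_apply block_linear)
  have \<beta>'_add: "\<beta>' (k + l) = \<epsilon> (A l k) * \<beta>' k * \<beta>' l" if kl: "k \<in> K" "l \<in> K" for k l
    using algebra_character_weyl_comp[OF \<zeta>' mem_S_A[OF kl(1)] mem_S_A[OF kl(2)] _ block_dual(1)]
      mem_S_A[OF K_add[OF kl]]
    by (simp add: \<beta>'_def linear_to_dual_add[OF A] \<epsilon>_uminus divide_simps mult_ac)
  have zero: "\<beta> 0 = 1" "\<beta>' 0 = 1"
    using \<tau>_zero by (simp_all add: \<beta>_def \<beta>'_def \<zeta>'_id zero_prod_def)
  have \<beta>_nonzero: "\<beta> k \<noteq> 0" for k
    using \<beta>_add[of k "- k"] zero by auto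
  have \<beta>'_nonzero: "\<beta>' k \<noteq> 0" if "k \<in> K" for k
    using \<beta>'_add[OF that K_uminus[OF that]] zero by auto
  have vs: "vector_space sG" by (simp add: fin_dim fin_dim_space_vector_space)
  \<comment> \<open>\<open>\<beta>\<close> and \<open>\<beta>'\<close> obey the same quadratic law
    on \<open>K\<close>, so the factor \<open>\<epsilon> (A l k)\<close> cancels in the ratio and a
    character of \<open>K\<close> remains.\<close>
  have "\<exists>\<phi>\<in>dual sG. \<forall>k\<in>K. \<epsilon> (A k d) * \<beta> k / \<beta>' k = \<epsilon> (\<phi> k)"
  proof (rule character_eq_pairing)
    show "finite (dual sG)"
      by (rule finite_subset[OF subset_UNIV]) (simp add: finite_UNIV_fun)
    show "0 \<in> dual sG" by (simp add: mem_dual_iff[OF vs])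
    show "\<phi> - \<phi>' \<in> dual sG" if "\<phi> \<in> dual sG" "\<phi>' \<in> dual sG" for \<phi> \<phi>'
      using that by (simp add: mem_dual_iff[OF vs] algebra_simps)
    show "\<exists>\<phi>\<in>dual sG. \<epsilon> (\<phi> k) \<noteq> 1" if k: "k \<noteq> 0" for k
    proof -
      obtain \<phi> where \<phi>: "\<phi> \<in> dual sG" "\<phi> k \<noteq> 0"
        using dual_separates[OF fin_dim(3) k] by blast
      then obtain a where "\<epsilon> (a * \<phi> k) \<noteq> 1" using \<epsilon>_mult_nontrivial by blast
      moreover have "dual_scale a \<phi> \<in> dual sG"
        using \<phi>(1) by (simp add: mem_dual_iff[OF vs] dual_scale_def algebra_simps)
      ultimately show ?thesis by (auto simp: dual_scale_def)
    qed
    show "\<epsilon> (A (k + l) d) * \<beta> (k + l) / \<beta>' (k + l) =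
        \<epsilon> (A k d) * \<beta> k / \<beta>' k * (\<epsilon> (A l d) * \<beta> l / \<beta>' l)" if "k \<in> K" "l \<in> K" for k l
      by (simp add: \<beta>_add \<beta>'_add[OF that] block_linear \<epsilon>_add)
  qed (auto simp: K_diff dual_zero dual_add \<epsilon>_add zero)
  then obtain \<phi> where \<phi>: "\<phi> \<in> dual sG" "\<And>k. k \<in> K \<Longrightarrow> \<epsilon> (A k d) * \<beta> k / \<beta>' k = \<epsilon> (\<phi> k)"
    by blast
  have "\<beta>' k = \<epsilon> (A k d - \<phi> k) * \<beta> k" if "k \<in> K" for k
    using \<phi>(2)[OF that] \<beta>'_nonzero[OF that] by (simp add: \<epsilon>_diff divide_simps mult_ac)
  then have "weyl \<chi> \<phi> d ` joint_eigenspace \<alpha> \<beta> = joint_eigenspace (\<lambda>f. \<sigma> (C f)) \<beta>'"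
    by (intro weyl_joint_eigenspace \<phi>(1) \<alpha>')
  with \<phi>(1) show ?thesis
    unfolding equivalent_codes_def graph stabilizer by (intro bexI exI)
qed

end

theorem mainTheorem2:
  fixes scaleH :: "'k::{field,finite} \<Rightarrow> 'h::ab_group_add \<Rightarrow> 'h"
    and scaleF :: "'k \<Rightarrow> 'f::ab_group_add \<Rightarrow> 'f"
    and scaleG :: "'k \<Rightarrow> 'g::ab_group_add \<Rightarrow> 'g"
    and \<chi> :: "'k \<Rightarrow> 'k \<Rightarrow> complex"
    and A :: "'g \<Rightarrow> ('g \<Rightarrow> 'k)"
    and B :: "'h \<Rightarrow> ('g \<Rightarrow> 'k)"
    and C :: "'f \<Rightarrow> ('g \<Rightarrow> 'k)"
    and \<Gamma> :: "'h \<times> 'f \<times> 'g \<Rightarrow> ('h \<times> 'f \<times> 'g \<Rightarrow> 'k)"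
    and S :: "(('g \<Rightarrow> 'k) \<times> 'g) set"
  assumes "fin_dim_space scaleH" and "fin_dim_space scaleF" and "fin_dim_space scaleG"
    and "symmetric_character_iso \<chi>"
    and "linear_to_dual scaleG scaleG A"
    and "linear_to_dual scaleH scaleG B" and "inj B"
    and "linear_to_dual scaleF scaleG C"
    and "\<Gamma> = block_operator A B C"
    and "symmetric_operator (prod_scale scaleH (prod_scale scaleF scaleG)) \<Gamma>"
    and "S = {(A k + t, k) | k t. dual_adjoint B k = 0 \<and> dual_adjoint C k = 0 \<and> t \<in> range C}"
  shows "isotropic scaleG S \<and>
    (\<exists>c :: ('h \<Rightarrow> complex, 'g) code. is_graph_code \<chi> \<Gamma> c \<and> protected_subspace c \<noteq> {0}) \<and>
    (\<forall>(c :: ('h \<Rightarrow> complex, 'g) code) c'.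
       is_graph_code \<chi> \<Gamma> c \<and> protected_subspace c \<noteq> {0} \<and> is_stabilizer_code \<chi> S c' \<longrightarrow>
       equivalent_codes \<chi> scaleG c c')"
proof -
  interpret graph_operator \<chi> scaleH scaleF scaleG A B C \<Gamma>
    by unfold_locales (rule assms)+
  have "S = graph_operator.S A B C"
    by (auto simp: assms(11) S_def K_def dual_adjoint_def fun_eq_iff)
  then show ?thesis
    using S_isotropic ex_nonzero_graph_code nonzero_graph_code_equivalent by auto
qed

end
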